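(* Let $X$ and $Y$ be configurations of the same polygonal chain such that $Y$ is an expansion of $X$, and let a symmetric slender adornment be attached to each bar (the adornments may overlap). Then the area of the union of the adornments in $Y$ is at least the area of the union of the adornments in $X$.
   Context: An adornment is a compact simply connected region $S\subset\mathbb{R}^2$ together with a segment $[x,y]$, $x\ne y$, with endpoints on the boundary of $S$ and $[x,y]\subseteq S$ (the base); its boundary consists of two arcs from $x$ to $y$ (the sides). It is slender if, for a point $p$ moving along either side from $x$ to $y$, $\|p-x\|$ is nondecreasing and $\|p-y\|$ is nonincreasing; it is symmetric if invariant under reflection in the line through $x,y$. A configuration of a polygonal chain assigns vertex positions preserving bar lengths; an adornment attached to a bar moves with it rigidly, and points of the chain in two configurations correspond via these rigid motions. $Y$ is an expansion of $X$ if for any two points $p,q$ of the chain in $X$, the corresponding points $p',q'$ in $Y$ satisfy $\|p'-q'\|\ge\|p-q\|$. *)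

theory Defs
  imports "HOL-Analysis.Analysis"
begin

definition adornment_sides :: "complex set \<Rightarrow> complex \<Rightarrow> complex \<Rightarrow> (real \<Rightarrow> complex) \<Rightarrow> (real \<Rightarrow> complex) \<Rightarrow> bool" where
  "adornment_sides S x y g1 g2 \<longleftrightarrow>
     compact S \<and> simply_connected S \<and> x \<noteq> y \<and>
     x \<in> frontier S \<and> y \<in> frontier S \<and> closed_segment x y \<subseteq> S \<and>
     arc g1 \<and> arc g2 \<and>
     pathstart g1 = x \<and> pathfinish g1 = y \<and> pathstart g2 = x \<and> pathfinish g2 = y \<and>
     path_image g1 \<union> path_image g2 = frontier S \<and>
     path_image g1 \<inter> path_image g2 = {x, y}"

definition adornment :: "complex set \<Rightarrow> complex \<Rightarrow> complex \<Rightarrow> bool" where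
  "adornment S x y \<longleftrightarrow> (\<exists>g1 g2. adornment_sides S x y g1 g2)"

definition slender_side :: "complex \<Rightarrow> complex \<Rightarrow> (real \<Rightarrow> complex) \<Rightarrow> bool" where
  "slender_side x y g \<longleftrightarrow>
     (\<forall>s\<in>{0..1}. \<forall>t\<in>{0..1}. s \<le> t \<longrightarrow>
        dist (g s) x \<le> dist (g t) x \<and> dist (g t) y \<le> dist (g s) y)"

definition slender_adornment :: "complex set \<Rightarrow> complex \<Rightarrow> complex \<Rightarrow> bool" where
  "slender_adornment S x y \<longleftrightarrow>
     (\<exists>g1 g2. adornment_sides S x y g1 g2 \<and> slender_side x y g1 \<and> slender_side x y g2)"

definition reflect_line :: "complex \<Rightarrow> complex \<Rightarrow> complex \<Rightarrow> complex" where
  "reflect_line x y z = x + (y - x) * cnj ((z - x) / (y - x))"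

definition symmetric_adornment :: "complex set \<Rightarrow> complex \<Rightarrow> complex \<Rightarrow> bool" where
  "symmetric_adornment S x y \<longleftrightarrow> reflect_line x y ` S = S"

text \<open>Polygonal chain configurations: vertex positions p 0, ..., p n; bar i is
  [p i, p (Suc i)] for i < n.  The point with parameter t \<in> [0,1] on bar i.\<close>
definition chain_point :: "(nat \<Rightarrow> complex) \<Rightarrow> nat \<Rightarrow> real \<Rightarrow> complex" where
  "chain_point p i t = p i + of_real t * (p (Suc i) - p i)"

definition same_chain :: "nat \<Rightarrow> (nat \<Rightarrow> complex) \<Rightarrow> (nat \<Rightarrow> complex) \<Rightarrow> bool" where
  "same_chain n p q \<longleftrightarrow> (\<forall>i<n. dist (q i) (q (Suc i)) = dist (p i) (p (Suc i)))"

definition expansion :: "nat \<Rightarrow> (nat \<Rightarrow> complex) \<Rightarrow> (nat \<Rightarrow> complex) \<Rightarrow> bool" where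
  "expansion n p q \<longleftrightarrow>
     (\<forall>i<n. \<forall>j<n. \<forall>s\<in>{0..1}. \<forall>t\<in>{0..1}.
        dist (chain_point p i s) (chain_point p j t) \<le> dist (chain_point q i s) (chain_point q j t))"

definition bar_motion :: "(nat \<Rightarrow> complex) \<Rightarrow> (nat \<Rightarrow> complex) \<Rightarrow> nat \<Rightarrow> complex \<Rightarrow> complex" where
  "bar_motion p q i z = q i + (z - p i) * ((q (Suc i) - q i) / (p (Suc i) - p i))"

end

theory Submission
  imports Defs "HOL-Probability.Distributions" "HOL-Real_Asymp.Real_Asymp"
begin

text \<open>A symmetric slender adornment on the base \<open>[x, y]\<close> is the union of the lenses
  \<open>cball x a \<inter> cball y b\<close> over the pairs of distances \<open>(a, b)\<close> from \<open>x\<close> and \<open>y\<close> that occur on its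
  frontier. By compactness it therefore suffices to show that the area of a finite union of lenses
  does not decrease when the centres move apart while the two centres of each lens keep their
  distance, a case of the Kneser-Poulsen theorem.

  Approximate the indicator of \<open>norm (z - p) < r\<close> by a polynomial in
  \<open>exp (- c * (norm (z - p))\<^sup>2)\<close>. The indicator of the union of lenses becomes a combination \<open>h\<close> of
  exponentials \<open>exp (- (\<Sum>j. l j * u j))\<close> in the squared distances \<open>u j\<close> of \<open>z\<close> from the centres,
  and the integral of each of these is \<open>\<pi> / \<Lambda> * exp (- Q / \<Lambda>)\<close> with \<open>\<Lambda> = (\<Sum>j. l j)\<close> and \<open>Q\<close> linear in the
  squared mutual distances of the centres. Interpolate these squared distances linearly: the
  derivative with respect to that of centres \<open>i\<close> and \<open>j\<close> is \<open>- 1 / \<pi>\<close> times the integral of the mixed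
  partial derivative of \<open>h\<close> over four-dimensional space, where the interpolated distances are
  realised by actual points. That partial derivative is nonpositive for centres of different
  lenses.\<close>

section \<open>Gaussian integrals of exponential combinations\<close>

lemma nn_integral_gaussian:
  fixes a c :: real
  assumes "a > 0"
  shows "(\<integral>\<^sup>+x. ennreal (exp (- a * (x - c)\<^sup>2)) \<partial>lborel) = ennreal (sqrt (pi / a))"
proof -
  define s where "s = 1 / sqrt (2 * a)"
  have s: "s > 0" "s\<^sup>2 = 1 / (2 * a)"
    using assms by (auto simp: s_def power_divide)
  have eq: "exp (- a * (x - c)\<^sup>2) = sqrt (pi / a) * normal_density c s x" for x
    using assms by (simp add: normal_density_def s real_sqrt_divide field_simps)
  have "(\<integral>\<^sup>+x. ennreal (exp (- a * (x - c)\<^sup>2)) \<partial>lborel)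
      = ennreal (\<integral>x. sqrt (pi / a) * normal_density c s x \<partial>lborel)"
    unfolding eq using assms s by (intro nn_integral_eq_integral) auto
  then show ?thesis
    using s by simp
qed

lemma has_bochner_integral_gaussian_complex:
  fixes c :: complex
  assumes "a > 0"
  shows "has_bochner_integral lborel (\<lambda>z. exp (- a * (dist z c)\<^sup>2)) (pi / a)"
proof (rule has_bochner_integral_nn_integral)
  have "exp (- a * (dist z c)\<^sup>2) = (\<Prod>b\<in>Basis. exp (- a * (z \<bullet> b - c \<bullet> b)\<^sup>2))" for z :: complex
    by (simp add: Basis_complex_def complex_i_not_one dist_norm cmod_power2 exp_add[symmetric] inner_complex_def algebra_simps)
  then have "(\<integral>\<^sup>+z. ennreal (exp (- a * (dist z c)\<^sup>2)) \<partial>lborel)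
     = (\<integral>\<^sup>+z. (\<Prod>b\<in>Basis. ennreal (exp (- a * (z \<bullet> b - c \<bullet> b)\<^sup>2))) \<partial>lborel)"
    by (simp add: prod_ennreal)
  also have "\<dots> = (\<Prod>b\<in>Basis. (\<integral>\<^sup>+x. ennreal (exp (- a * (x - c \<bullet> b)\<^sup>2)) \<partial>lborel))"
    by (rule nn_integral_lborel_prod) auto
  also have "\<dots> = (\<Prod>b\<in>(Basis::complex set). ennreal (sqrt (pi / a)))"
    by (simp only: nn_integral_gaussian[OF assms])
  also have "\<dots> = ennreal (pi / a)"
    using assms by (simp add: DIM_complex power2_eq_square ennreal_mult[symmetric])
  finally show "(\<integral>\<^sup>+z. ennreal (exp (- a * (dist z c)\<^sup>2)) \<partial>lborel) = ennreal (pi / a)" .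
qed (use assms in auto)

text \<open>The linear form \<open>Q\<close> in the squared mutual distances. Halving the sum over
  ordered pairs counts each unordered pair once.\<close>

definition pair_energy :: "'j set \<Rightarrow> ('j \<Rightarrow> complex) \<Rightarrow> ('j \<Rightarrow> real) \<Rightarrow> real" where
  "pair_energy J P l = (\<Sum>i\<in>J. \<Sum>j\<in>J. l i * l j * (dist (P i) (P j))\<^sup>2) / 2"

text \<open>The squared distances enter as a free argument \<open>u\<close>, so that partial
  derivatives in them make sense and sign conditions can be stated without placing points in the
  plane.\<close>

definition expo :: "'j set \<Rightarrow> ('j \<Rightarrow> real) \<Rightarrow> ('j \<Rightarrow> real) \<Rightarrow> real" where
  "expo J u l = exp (- (\<Sum>j\<in>J. l j * u j))"

text \<open>Completing the square at the weighted barycentre (the parallel axis identity). The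
  remaining constant depends on the centres only through their mutual distances.\<close>

lemma weighted_sq_dist:
  fixes P :: "'j \<Rightarrow> complex"
  assumes "sum l J > 0"
  shows "(\<Sum>j\<in>J. l j * (dist z (P j))\<^sup>2) =
    sum l J * (dist z ((\<Sum>j\<in>J. l j *\<^sub>R P j) /\<^sub>R sum l J))\<^sup>2 + pair_energy J P l / sum l J"
proof -
  define T where "T = (\<Sum>j\<in>J. l j * (P j \<bullet> P j))"
  define S where "S = (\<Sum>j\<in>J. l j *\<^sub>R P j)"
  define m where "m = sum l J"
  have d: "(dist x y)\<^sup>2 = x \<bullet> x - 2 * (x \<bullet> y) + y \<bullet> y" for x y :: complex
    by (simp add: dist_norm power2_norm_eq_inner inner_diff inner_commute)
  have S: "(\<Sum>j\<in>J. l j * (x \<bullet> P j)) = x \<bullet> S" for x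
    by (simp add: S_def inner_sum_right)
  have one: "(\<Sum>j\<in>J. l j * (dist x (P j))\<^sup>2) = m * (x \<bullet> x) - 2 * (x \<bullet> S) + T" for x
    by (simp add: d algebra_simps sum.distrib sum_subtractf T_def m_def S[symmetric]
        sum_distrib_left sum_distrib_right)
  \<comment> \<open>Summing \<open>one\<close> over \<open>x = P i\<close> with weights
    \<open>l i\<close> expresses the pair energy by the same moments \<open>m\<close>,
    \<open>S\<close> and \<open>T\<close>.\<close>
  have "2 * pair_energy J P l = (\<Sum>i\<in>J. l i * (m * (P i \<bullet> P i) - 2 * (P i \<bullet> S) + T))"
    by (simp add: pair_energy_def one[symmetric] sum_distrib_left[symmetric] mult.assoc)
  also have "\<dots> = m * (\<Sum>i\<in>J. l i * (P i \<bullet> P i)) - 2 * (\<Sum>i\<in>J. l i * (S \<bullet> P i)) + (\<Sum>i\<in>J. l i) * T"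
    by (simp add: algebra_simps sum.distrib sum_subtractf
        sum_distrib_left inner_commute)
  also have "\<dots> = m * T - 2 * (\<Sum>i\<in>J. l i * (S \<bullet> P i)) + m * T"
    by (simp add: T_def m_def)
  also have "\<dots> = 2 * (m * T - S \<bullet> S)"
    unfolding S by simp
  finally have two: "pair_energy J P l = m * T - S \<bullet> S"
    by simp
  have three: "(dist z (S /\<^sub>R m))\<^sup>2 = z \<bullet> z - 2 * (z \<bullet> S) / m + (S \<bullet> S) / m\<^sup>2"
    unfolding d by (simp add: power2_eq_square divide_inverse)
  show ?thesis
    using assms unfolding S_def[symmetric] m_def[symmetric] one two three
    by (simp add: field_simps power2_eq_square)
qed

lemma has_bochner_integral_expo:
  fixes P :: "'j \<Rightarrow> complex"
  assumes "sum l J > 0"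
  shows "has_bochner_integral lborel (\<lambda>z. expo J (\<lambda>j. (dist z (P j))\<^sup>2) l)
    (pi / sum l J * exp (- (pair_energy J P l / sum l J)))"
proof -
  have "has_bochner_integral lborel (\<lambda>z. exp (- sum l J * (dist z ((\<Sum>j\<in>J. l j *\<^sub>R P j) /\<^sub>R sum l J))\<^sup>2)
     * exp (- (pair_energy J P l / sum l J))) (pi / sum l J * exp (- (pair_energy J P l / sum l J)))"
    by (intro has_bochner_integral_mult_left has_bochner_integral_gaussian_complex assms)
  then show ?thesis
    by (simp add: expo_def weighted_sq_dist[OF assms] exp_add[symmetric] algebra_simps)
qed

lemma has_bochner_integral_nonpos:
  fixes f :: "'a \<Rightarrow> real"
  assumes "has_bochner_integral M f x" "\<And>z. f z \<le> 0"
  shows "x \<le> 0"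
proof -
  have "has_bochner_integral M (\<lambda>z. - f z) (- x)"
    using assms(1) by (rule has_bochner_integral_minus)
  then have "- x = (\<integral>z. - f z \<partial>M)"
    by (rule has_bochner_integral_integral_eq[symmetric])
  also have "\<dots> \<ge> 0"
    using assms(2) by (intro integral_nonneg_AE) auto
  finally show ?thesis by simp
qed

section \<open>Finite combinations of exponentials and their integrals\<close>

text \<open>A list of coefficients and exponent vectors encodes a function. Since \<open>f\<close>
  is arbitrary, one list yields its values, its derivatives and its integral.\<close>

definition lincomb :: "(real \<times> ('j \<Rightarrow> real)) list \<Rightarrow> (('j \<Rightarrow> real) \<Rightarrow> real) \<Rightarrow> real" where
  "lincomb L f = (\<Sum>(c, l)\<leftarrow>L. c * f l)"

lemma lincomb_Nil [simp]: "lincomb [] f = 0"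
  and lincomb_Cons [simp]: "lincomb (x # L) f = fst x * f (snd x) + lincomb L f"
  and lincomb_append [simp]: "lincomb (L @ M) f = lincomb L f + lincomb M f"
  by (simp_all add: lincomb_def split_beta)

lemma lincomb_cong: "(\<And>l. l \<in> snd ` set L \<Longrightarrow> f l = g l) \<Longrightarrow> lincomb L f = lincomb L g"
  by (induction L) auto

lemma lincomb_mult_left: "lincomb L (\<lambda>l. k * f l) = k * lincomb L f"
  by (induction L) (auto simp: algebra_simps)

lemma lincomb_mult_right: "lincomb L (\<lambda>l. f l * k) = lincomb L f * k"
  by (induction L) (auto simp: algebra_simps)

lemma lincomb_add: "lincomb L (\<lambda>l. f l + g l) = lincomb L f + lincomb L g"
  by (induction L) (auto simp: algebra_simps)

lemma lincomb_sum: "lincomb L (\<lambda>l. \<Sum>i\<in>A. f i l) = (\<Sum>i\<in>A. lincomb L (f i))"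
  by (induction L) (auto simp: sum.distrib sum_distrib_left)

lemma DERIV_lincomb:
  assumes "\<And>l. l \<in> snd ` set L \<Longrightarrow> ((\<lambda>t. f t l) has_real_derivative f' l) (at t)"
  shows "((\<lambda>t. lincomb L (f t)) has_real_derivative lincomb L f') (at t)"
  using assms by (induction L) (auto intro!: derivative_eq_intros)

text \<open>A positive total exponent makes each exponential of squared distances integrable over
  the plane.\<close>

definition admissible :: "'j set \<Rightarrow> (real \<times> ('j \<Rightarrow> real)) list \<Rightarrow> bool" where
  "admissible J L \<longleftrightarrow> (\<forall>l \<in> snd ` set L. (\<forall>j. 0 \<le> l j) \<and> 0 < sum l J)"

lemma has_bochner_integral_lincomb_expo:
  fixes P :: "'j \<Rightarrow> complex"
  assumes "admissible J L"
  shows "has_bochner_integral lborel (\<lambda>z. lincomb L (\<lambda>l. g l * expo J (\<lambda>j. (dist z (P j))\<^sup>2) l))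
    (lincomb L (\<lambda>l. g l * (pi / sum l J * exp (- (pair_energy J P l / sum l J)))))"
  using assms
proof (induction L)
  case (Cons x L)
  then have "0 < sum (snd x) J" "admissible J L"
    by (auto simp: admissible_def)
  with Cons.IH show ?case
    unfolding lincomb_Cons
    by (intro has_bochner_integral_add has_bochner_integral_mult_right has_bochner_integral_expo)
qed auto

lemma expo_mult: "expo J u l * expo J v l = expo J (\<lambda>j. u j + v j) l"
  by (simp add: expo_def exp_add[symmetric] sum.distrib algebra_simps)

lemma expo_add: "expo J u (\<lambda>j. l j + m j) = expo J u l * expo J u m"
  by (simp add: expo_def exp_add[symmetric] sum.distrib algebra_simps)

lemma pair_energy_scaleR: "pair_energy J (\<lambda>j. r *\<^sub>R P j) l = r\<^sup>2 * pair_energy J P l"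
proof -
  have "dist (r *\<^sub>R P i) (r *\<^sub>R P j) = \<bar>r\<bar> * dist (P i) (P j)" for i j
    by (metis dist_norm norm_scaleR scaleR_diff_right)
  then show ?thesis
    by (simp add: pair_energy_def sum_distrib_left power_mult_distrib algebra_simps)
qed

text \<open>The left-hand side is the integral over \<open>\<complex> \<times> \<complex>\<close> for the points
  \<open>(sqrt (1 - t) P j, sqrt t Q j)\<close>, whose squared distances interpolate linearly between those
  of \<open>P\<close> and \<open>Q\<close>.\<close>
lemma lincomb_gaussian4_nonpos:
  fixes P Q :: "'j \<Rightarrow> complex"
  assumes L: "admissible J L" and t: "0 \<le> t" "t \<le> 1"
    and nonpos: "\<And>u. (\<And>j. 0 \<le> u j) \<Longrightarrow> lincomb L (\<lambda>l. g l * expo J u l) \<le> 0"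
  shows "lincomb L (\<lambda>l. g l * (pi / sum l J)\<^sup>2 *
     exp (- (((1 - t) * pair_energy J P l + t * pair_energy J Q l) / sum l J))) \<le> 0"
proof -
  define P' where "P' = (\<lambda>j. sqrt (1 - t) *\<^sub>R P j)"
  define Q' where "Q' = (\<lambda>j. sqrt t *\<^sub>R Q j)"
  define G where "G = (\<lambda>R l. pi / sum l J * exp (- (pair_energy J R l / sum l J)))"
  have e: "pair_energy J P' l = (1 - t) * pair_energy J P l" "pair_energy J Q' l = t * pair_energy J Q l" for l
    using t by (simp_all add: P'_def Q'_def pair_energy_scaleR)
  \<comment> \<open>The four-dimensional integral is taken iteratively: for fixed \<open>z\<close>
    the factor in \<open>z\<close> is absorbed into the coefficients \<open>k\<close> and the other
    plane is integrated first. The sign survives each integration.\<close>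
  have inner: "lincomb L (\<lambda>l. (g l * G Q' l) * expo J (\<lambda>j. (dist z (P' j))\<^sup>2) l) \<le> 0" for z
  proof -
    define k where "k = (\<lambda>l. g l * expo J (\<lambda>j. (dist z (P' j))\<^sup>2) l)"
    have "has_bochner_integral lborel (\<lambda>w. lincomb L (\<lambda>l. k l * expo J (\<lambda>j. (dist w (Q' j))\<^sup>2) l))
      (lincomb L (\<lambda>l. k l * G Q' l))"
      unfolding G_def by (rule has_bochner_integral_lincomb_expo[OF L])
    moreover have "lincomb L (\<lambda>l. k l * expo J (\<lambda>j. (dist w (Q' j))\<^sup>2) l) \<le> 0" for w
      unfolding k_def mult.assoc expo_mult by (rule nonpos) auto
    ultimately have "lincomb L (\<lambda>l. k l * G Q' l) \<le> 0"
      by (rule has_bochner_integral_nonpos)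
    then show ?thesis
      by (simp add: k_def mult_ac)
  qed
  have "has_bochner_integral lborel (\<lambda>z. lincomb L (\<lambda>l. (g l * G Q' l) * expo J (\<lambda>j. (dist z (P' j))\<^sup>2) l))
      (lincomb L (\<lambda>l. (g l * G Q' l) * G P' l))"
    unfolding G_def by (rule has_bochner_integral_lincomb_expo[OF L])
  then have "lincomb L (\<lambda>l. (g l * G Q' l) * G P' l) \<le> 0"
    using inner by (rule has_bochner_integral_nonpos)
  moreover have "(g l * G Q' l) * G P' l = g l * (pi / sum l J)\<^sup>2 *
     exp (- (((1 - t) * pair_energy J P l + t * pair_energy J Q l) / sum l J))" for l
    unfolding G_def e by (simp add: power2_eq_square exp_add[symmetric] add_divide_distrib mult_ac)
  ultimately show ?thesis
    by simp
qed

text \<open>Along the linear interpolation of squared distances, the derivative of the integral is a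
  sum over pairs of the increment of the squared distance times a four-dimensional Gaussian integral
  of known sign. Pairs with unchanged distance contribute zero, so the sign condition concerns only
  the others.\<close>

lemma integral_lincomb_expo_mono:
  fixes P Q :: "'j \<Rightarrow> complex"
  assumes L: "admissible J L"
    and le: "\<And>i j. i \<in> J \<Longrightarrow> j \<in> J \<Longrightarrow> dist (P i) (P j) \<le> dist (Q i) (Q j)"
    and sgn: "\<And>i j u. i \<in> J \<Longrightarrow> j \<in> J \<Longrightarrow> dist (P i) (P j) \<noteq> dist (Q i) (Q j) \<Longrightarrow>
       (\<And>j. 0 \<le> u j) \<Longrightarrow> lincomb L (\<lambda>l. l i * l j * expo J u l) \<le> 0"
  shows "(\<integral>z. lincomb L (expo J (\<lambda>j. (dist z (P j))\<^sup>2)) \<partial>lborel)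
       \<le> (\<integral>z. lincomb L (expo J (\<lambda>j. (dist z (Q j))\<^sup>2)) \<partial>lborel)"
proof -
  define H where "H = (\<lambda>t l. exp (- (((1 - t) * pair_energy J P l + t * pair_energy J Q l) / sum l J)))"
  define F where "F = (\<lambda>t. lincomb L (\<lambda>l. pi / sum l J * H t l))"
  define \<delta> where "\<delta> = (\<lambda>i j. (dist (Q i) (Q j))\<^sup>2 - (dist (P i) (P j))\<^sup>2)"
  have end0: "(\<integral>z. lincomb L (expo J (\<lambda>j. (dist z (R j))\<^sup>2)) \<partial>lborel)
      = lincomb L (\<lambda>l. pi / sum l J * exp (- (pair_energy J R l / sum l J)))" for R
    using has_bochner_integral_integral_eq[OF has_bochner_integral_lincomb_expo[OF L, of "\<lambda>_. 1" R]] by simp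
  have "F 0 \<le> F 1"
  proof (rule DERIV_nonneg_imp_nondecreasing[of 0 1])
    fix t :: real assume t: "0 \<le> t" "t \<le> 1"
    define d where "d = lincomb L (\<lambda>l. pi / sum l J * H t l * ((pair_energy J P l - pair_energy J Q l) / sum l J))"
    have "(F has_real_derivative d) (at t)"
      unfolding F_def d_def
    proof (rule DERIV_lincomb)
      fix l assume "l \<in> snd ` set L"
      then have "sum l J > 0"
        using L by (auto simp: admissible_def)
      then show "((\<lambda>t. pi / sum l J * H t l) has_real_derivative
         pi / sum l J * H t l * ((pair_energy J P l - pair_energy J Q l) / sum l J)) (at t)"
        unfolding H_def by (auto intro!: derivative_eq_intros simp: field_simps)
    qed
    moreover have "d \<ge> 0"
    proof -
      have diff: "pair_energy J P l - pair_energy J Q l = - (\<Sum>i\<in>J. \<Sum>j\<in>J. \<delta> i j * (l i * l j)) / 2" for l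
        by (simp add: pair_energy_def \<delta>_def sum_subtractf algebra_simps diff_divide_distrib)
      \<comment> \<open>Differentiating the exponent supplies a second factor
        \<open>1 / sum l J\<close>. Together with \<open>pi / sum l J\<close> it is the
        four-dimensional normalisation \<open>(pi / sum l J)\<^sup>2\<close>, up to division by
        \<open>pi\<close>.\<close>
      have "d = lincomb L (\<lambda>l. (\<Sum>i\<in>J. \<Sum>j\<in>J. \<delta> i j * (l i * l j * (pi / sum l J)\<^sup>2 * H t l)) * (- (1 / (2 * pi))))"
        unfolding d_def diff
        by (rule lincomb_cong) (simp add: sum_distrib_left sum_distrib_right power2_eq_square
            sum_divide_distrib sum_negf[symmetric] field_simps)
      also have "\<dots> = (\<Sum>i\<in>J. \<Sum>j\<in>J. \<delta> i j * lincomb L (\<lambda>l. l i * l j * (pi / sum l J)\<^sup>2 * H t l)) * (- (1 / (2 * pi)))"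
        by (simp only: lincomb_mult_right lincomb_sum lincomb_mult_left)
      finally have d: "d = (\<Sum>i\<in>J. \<Sum>j\<in>J. \<delta> i j * lincomb L (\<lambda>l. l i * l j * (pi / sum l J)\<^sup>2 * H t l)) * (- (1 / (2 * pi)))" .
      have "\<delta> i j * lincomb L (\<lambda>l. l i * l j * (pi / sum l J)\<^sup>2 * H t l) \<le> 0" if "i \<in> J" "j \<in> J" for i j
      proof (cases "dist (P i) (P j) = dist (Q i) (Q j)")
        case False
        have "\<delta> i j \<ge> 0"
          unfolding \<delta>_def using le[OF that] by (simp add: power_mono)
        moreover have "lincomb L (\<lambda>l. l i * l j * (pi / sum l J)\<^sup>2 * H t l) \<le> 0"
          unfolding H_def by (rule lincomb_gaussian4_nonpos[OF L t sgn[OF that False]]) auto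
        ultimately show ?thesis
          by (simp add: mult_nonneg_nonpos)
      qed (simp add: \<delta>_def)
      then show ?thesis
        unfolding d by (intro mult_nonpos_nonpos sum_nonpos) auto
    qed
    ultimately show "\<exists>y. (F has_real_derivative y) (at t) \<and> 0 \<le> y"
      by blast
  qed simp
  then show ?thesis
    by (simp add: end0 F_def H_def)
qed

section \<open>Area of unions of lenses\<close>

text \<open>Represents the product of the two functions, because multiplying exponentials adds their
  exponents.\<close>

definition conv :: "(real \<times> ('j \<Rightarrow> real)) list \<Rightarrow> (real \<times> ('j \<Rightarrow> real)) list \<Rightarrow> (real \<times> ('j \<Rightarrow> real)) list" where
  "conv L M = concat (map (\<lambda>(c, l). map (\<lambda>(d, m). (c * d, \<lambda>j. l j + m j)) M) L)"

text \<open>Represents \<open>1 - (1 - f) * (1 - g)\<close> without a constant term, which would not be integrable.\<close>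
definition disj :: "(real \<times> ('j \<Rightarrow> real)) list \<Rightarrow> (real \<times> ('j \<Rightarrow> real)) list \<Rightarrow> (real \<times> ('j \<Rightarrow> real)) list" where
  "disj L M = L @ M @ map (\<lambda>(c, l). (- c, l)) (conv L M)"

lemma lincomb_map_mult: "lincomb (map (\<lambda>(d, m). (c * d, h m)) M) f = c * lincomb M (\<lambda>m. f (h m))"
  by (induction M) (auto simp: algebra_simps)

lemma lincomb_uminus: "lincomb (map (\<lambda>(c, l). (- c, l)) M) f = - lincomb M f"
  by (induction M) auto

lemma lincomb_conv: "lincomb (conv L M) f = lincomb L (\<lambda>l. lincomb M (\<lambda>m. f (\<lambda>j. l j + m j)))"
  by (induction L) (auto simp: conv_def lincomb_map_mult)

lemma lincomb_disj: "lincomb (disj L M) f = lincomb L f + lincomb M f - lincomb (conv L M) f"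
  by (simp add: disj_def lincomb_uminus)

lemma conv_exponentE:
  assumes "e \<in> snd ` set (conv L M)"
  obtains l m where "l \<in> snd ` set L" "m \<in> snd ` set M" "e = (\<lambda>j. l j + m j)"
  using assms by (force simp: conv_def)

lemma set_disj: "snd ` set (disj L M) = snd ` set L \<union> snd ` set M \<union> snd ` set (conv L M)"
  by (force simp: disj_def image_iff)

definition val :: "'j set \<Rightarrow> (real \<times> ('j \<Rightarrow> real)) list \<Rightarrow> ('j \<Rightarrow> real) \<Rightarrow> real" where
  "val J L u = lincomb L (expo J u)"

text \<open>Up to sign, the first and second partial derivatives of \<open>val\<close>.\<close>
definition val1 :: "'j set \<Rightarrow> (real \<times> ('j \<Rightarrow> real)) list \<Rightarrow> 'j \<Rightarrow> ('j \<Rightarrow> real) \<Rightarrow> real" where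
  "val1 J L i u = lincomb L (\<lambda>l. l i * expo J u l)"

definition val2 :: "'j set \<Rightarrow> (real \<times> ('j \<Rightarrow> real)) list \<Rightarrow> 'j \<Rightarrow> 'j \<Rightarrow> ('j \<Rightarrow> real) \<Rightarrow> real" where
  "val2 J L i j u = lincomb L (\<lambda>l. l i * l j * expo J u l)"

lemma val_conv: "val J (conv L M) u = val J L u * val J M u"
  by (simp add: val_def lincomb_conv expo_add lincomb_mult_left lincomb_mult_right)

lemma val1_conv: "val1 J (conv L M) i u = val1 J L i u * val J M u + val J L u * val1 J M i u"
proof -
  have "(l i + m i) * (expo J u l * expo J u m) =
     (l i * expo J u l) * expo J u m + expo J u l * (m i * expo J u m)" for l m
    by (simp add: algebra_simps)
  then show ?thesis
    by (simp only: val_def val1_def lincomb_conv expo_add lincomb_add lincomb_mult_left lincomb_mult_right)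
qed

text \<open>The Leibniz rule for a mixed second derivative, obtained by expanding
  \<open>(l i + m i) * (l j + m j)\<close>.\<close>

lemma val2_conv: "val2 J (conv L M) i j u =
  val2 J L i j u * val J M u + val1 J L i u * val1 J M j u + val1 J L j u * val1 J M i u + val J L u * val2 J M i j u"
proof -
  have "(l i + m i) * (l j + m j) * (expo J u l * expo J u m) =
     (l i * l j * expo J u l) * expo J u m + (l i * expo J u l) * (m j * expo J u m)
     + (l j * expo J u l) * (m i * expo J u m) + expo J u l * (m i * m j * expo J u m)" for l m
    by (simp add: algebra_simps)
  then show ?thesis
    by (simp only: val_def val1_def val2_def lincomb_conv expo_add lincomb_add lincomb_mult_left lincomb_mult_right)
qed

lemma val_disj: "val J (disj L M) u = 1 - (1 - val J L u) * (1 - val J M u)"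
  by (simp add: val_def lincomb_disj val_conv[unfolded val_def] algebra_simps)

lemma val1_disj: "val1 J (disj L M) i u = val1 J L i u * (1 - val J M u) + (1 - val J L u) * val1 J M i u"
  by (simp add: val1_def lincomb_disj val1_conv[unfolded val1_def] algebra_simps)

lemma val2_disj: "val2 J (disj L M) i j u = val2 J L i j u * (1 - val J M u) + (1 - val J L u) * val2 J M i j u
   - val1 J L i u * val1 J M j u - val1 J L j u * val1 J M i u"
  unfolding val2_def lincomb_disj by (simp add: val2_conv[unfolded val2_def] ring_distribs)

section \<open>Sign conditions on mixed derivatives\<close>

text \<open>The first component of an index names the lens, so the last condition concerns centres
  of different lenses. The bounds on \<open>val\<close> and \<open>val1\<close> are what makes the
  class closed under \<open>disj\<close>.\<close>

definition submodular :: "('k \<times> 'b) set \<Rightarrow> (real \<times> ('k \<times> 'b \<Rightarrow> real)) list \<Rightarrow> bool" where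
  "submodular J L \<longleftrightarrow> admissible J L \<and>
     (\<forall>u. (\<forall>j. 0 \<le> u j) \<longrightarrow> 0 \<le> val J L u \<and> val J L u \<le> 1 \<and> (\<forall>i. 0 \<le> val1 J L i u) \<and>
        (\<forall>i j. fst i \<noteq> fst j \<longrightarrow> val2 J L i j u \<le> 0))"

text \<open>Expresses that the function depends only on the distances from the centres of lens
  \<open>k\<close>.\<close>

definition supported :: "'k \<Rightarrow> (real \<times> ('k \<times> 'b \<Rightarrow> real)) list \<Rightarrow> bool" where
  "supported k L \<longleftrightarrow> (\<forall>l \<in> snd ` set L. \<forall>i. fst i \<noteq> k \<longrightarrow> l i = 0)"

lemma supported_conv:
  fixes L :: "(real \<times> ('k \<times> 'b \<Rightarrow> real)) list"
  assumes "supported k L" "supported k M"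
  shows "supported k (conv L M)"
  unfolding supported_def
proof (intro ballI allI impI)
  fix e and i :: "'k \<times> 'b" assume e: "e \<in> snd ` set (conv L M)" and i: "fst i \<noteq> k"
  from e obtain l m where "l \<in> snd ` set L" "m \<in> snd ` set M" "e = (\<lambda>j. l j + m j)"
    by (rule conv_exponentE)
  moreover from this i have "l i = 0" "m i = 0"
    using assms unfolding supported_def by blast+
  ultimately show "e i = 0"
    by simp
qed

lemma supported_disj: "supported k L \<Longrightarrow> supported k M \<Longrightarrow> supported k (disj L M)"
  using supported_conv[of k L M] unfolding supported_def set_disj by blast

lemma supported_val2:
  assumes "supported k L" "fst i \<noteq> fst j"
  shows "val2 J L i j u = 0"
proof -
  have "val2 J L i j u = lincomb L (\<lambda>l. 0 * 0)"
    unfolding val2_def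
  proof (rule lincomb_cong)
    fix l assume "l \<in> snd ` set L"
    then have "l i = 0 \<or> l j = 0"
      using assms unfolding supported_def by metis
    then show "l i * l j * expo J u l = 0 * 0"
      by auto
  qed
  then show ?thesis
    by (simp only: lincomb_mult_left)
qed

lemma admissible_conv:
  assumes "admissible J L" "admissible J M"
  shows "admissible J (conv L M)"
  unfolding admissible_def
proof
  fix e assume "e \<in> snd ` set (conv L M)"
  then obtain l m where "l \<in> snd ` set L" "m \<in> snd ` set M" "e = (\<lambda>j. l j + m j)"
    by (rule conv_exponentE)
  moreover from this have "\<And>j. 0 \<le> l j" "\<And>j. 0 \<le> m j" "0 < sum l J" "0 < sum m J"
    using assms unfolding admissible_def by blast+
  ultimately show "(\<forall>j. 0 \<le> e j) \<and> 0 < sum e J"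
    by (simp add: sum.distrib add_pos_pos)
qed

lemma admissible_disj:
  assumes "admissible J L" "admissible J M"
  shows "admissible J (disj L M)"
  using assms admissible_conv[OF assms] unfolding admissible_def set_disj by blast

lemma submodular_Nil: "submodular J []"
  by (simp add: submodular_def admissible_def val_def val1_def val2_def)

text \<open>For \<open>1 - (1 - f) * (1 - g)\<close> the second derivatives of \<open>f\<close> and
  \<open>g\<close> carry the nonnegative weights \<open>1 - g\<close> and \<open>1 - f\<close>, and
  the products of first derivatives enter with a minus sign.\<close>

lemma submodular_disj:
  assumes "submodular J L" "submodular J M"
  shows "submodular J (disj L M)"
  unfolding submodular_def
proof (intro conjI allI impI)
  fix u :: "'a \<times> 'b \<Rightarrow> real" assume u: "\<forall>j. 0 \<le> u j"
  have L: "0 \<le> val J L u" "val J L u \<le> 1" "\<And>i. 0 \<le> val1 J L i u" "\<And>i j. fst i \<noteq> fst j \<Longrightarrow> val2 J L i j u \<le> 0"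
   and M: "0 \<le> val J M u" "val J M u \<le> 1" "\<And>i. 0 \<le> val1 J M i u" "\<And>i j. fst i \<noteq> fst j \<Longrightarrow> val2 J M i j u \<le> 0"
    using assms u by (auto simp: submodular_def)
  show "0 \<le> val J (disj L M) u" "val J (disj L M) u \<le> 1"
    using L M by (auto simp: val_disj intro!: mult_le_one)
  show "0 \<le> val1 J (disj L M) i u" for i
    using L M by (simp add: val1_disj)
  fix i j :: "'a \<times> 'b" assume ij: "fst i \<noteq> fst j"
  have "val2 J L i j u * (1 - val J M u) \<le> 0" "(1 - val J L u) * val2 J M i j u \<le> 0"
    using L(1,2) L(4)[OF ij] M(1,2) M(4)[OF ij] by (simp_all add: mult_nonpos_nonneg mult_nonneg_nonpos)
  moreover have "0 \<le> val1 J L i u * val1 J M j u" "0 \<le> val1 J L j u * val1 J M i u"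
    using L M by auto
  ultimately show "val2 J (disj L M) i j u \<le> 0"
    by (simp add: val2_disj)
qed (use assms in \<open>auto simp: submodular_def intro: admissible_disj\<close>)

text \<open>In a product the products of first derivatives have the opposite sign. Since both
  factors belong to the same lens, every mixed derivative across lenses vanishes.\<close>

lemma submodular_conv:
  assumes "submodular J L" "submodular J M" "supported k L" "supported k M"
  shows "submodular J (conv L M)"
  unfolding submodular_def
proof (intro conjI allI impI)
  fix u :: "'a \<times> 'b \<Rightarrow> real" assume u: "\<forall>j. 0 \<le> u j"
  have L: "0 \<le> val J L u" "val J L u \<le> 1" "\<And>i. 0 \<le> val1 J L i u"
   and M: "0 \<le> val J M u" "val J M u \<le> 1" "\<And>i. 0 \<le> val1 J M i u"
    using assms u by (auto simp: submodular_def)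
  show "0 \<le> val J (conv L M) u" "val J (conv L M) u \<le> 1"
    using L M by (auto simp: val_conv intro!: mult_le_one)
  show "0 \<le> val1 J (conv L M) i u" for i
    using L M by (simp add: val1_conv)
  show "val2 J (conv L M) i j u \<le> 0" if "fst i \<noteq> fst j" for i j
    using supported_val2[OF supported_conv[OF assms(3,4)] that, of J u] by simp
qed (use assms in \<open>auto simp: submodular_def intro: admissible_conv\<close>)

lemma val_single:
  assumes "finite J" "i \<in> J"
  shows "val J [(1, \<lambda>j. if j = i then c else 0)] u = exp (- (c * u i))"
proof -
  have "(\<Sum>j\<in>J. (if j = i then c else 0) * u j) = (\<Sum>j\<in>J. if j = i then c * u i else 0)"
    by (intro sum.cong) auto
  then show ?thesis
    using assms by (simp add: val_def expo_def)
qed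

lemma submodular_single:
  assumes "finite J" "i \<in> J" "c > 0"
  shows "submodular J [(1, \<lambda>j. if j = i then c else 0)]"
proof -
  have "admissible J [(1, \<lambda>j. if j = i then c else 0)]"
    using assms by (auto simp: admissible_def)
  then show ?thesis
    using \<open>c > 0\<close> unfolding submodular_def val_single[OF assms(1,2)]
    by (auto simp: val1_def val2_def expo_def simp del: split_paired_All)
qed

section \<open>Smooth approximation of discs and lenses\<close>

text \<open>With \<open>c = ln m / A\<close> this approximates the indicator of \<open>v < A\<close>
  as \<open>m\<close> grows. As a polynomial in \<open>exp (- (c * v))\<close> it has no constant
  term.\<close>

definition bump :: "nat \<Rightarrow> real \<Rightarrow> real \<Rightarrow> real" where
  "bump m c v = 1 - (1 - exp (- (c * v))) ^ m"

text \<open>The factorisation of \<open>1 - bump m c v\<close> into \<open>m\<close> equal factors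
  \<open>1 - exp (- (c * v))\<close> makes the bump an \<open>m\<close>-fold \<open>disj\<close> of
  a single exponential.\<close>

lemma ex_lincomb_bump:
  fixes J :: "('k \<times> 'b) set"
  assumes J: "finite J" "i \<in> J" and c: "c > 0"
  shows "\<exists>L. submodular J L \<and> supported (fst i) L \<and> (\<forall>u. val J L u = bump m c (u i))"
proof (induction m)
  case 0
  show ?case
    by (rule exI[of _ "[]"]) (simp add: submodular_Nil supported_def val_def bump_def)
next
  case (Suc m)
  then obtain L where L: "submodular J L" "supported (fst i) L" "\<And>u. val J L u = bump m c (u i)"
    by blast
  define S where "S = [(1::real, \<lambda>j. if j = i then c else 0)]"
  have v: "val J S u = exp (- (c * u i))" for u
    unfolding S_def using J by (rule val_single)
  have "submodular J S" "supported (fst i) S"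
    unfolding S_def using submodular_single[OF assms] by (auto simp: supported_def)
  then show ?case
    using L by (intro exI[of _ "disj S L"])
      (auto simp: submodular_disj supported_disj val_disj v bump_def)
qed

text \<open>The two bumps of a lens are multiplied by \<open>conv\<close>, and the lenses are joined
  by \<open>disj\<close>. The induction runs over subsets of \<open>K\<close> so that the index set
  \<open>?J\<close> stays fixed.\<close>

lemma ex_lincomb_lenses:
  fixes K :: "'k set" and r s :: "'k \<Rightarrow> real"
  assumes "finite K" and rs: "\<And>k. k \<in> K \<Longrightarrow> r k > 0 \<and> s k > 0"
  shows "\<exists>L. submodular (K \<times> (UNIV :: bool set)) L \<and>
    (\<forall>u. val (K \<times> UNIV) L u = 1 - (\<Prod>k\<in>K. 1 - bump m (r k) (u (k, True)) * bump m (s k) (u (k, False))))"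
proof -
  let ?J = "K \<times> (UNIV :: bool set)"
  have J: "finite ?J"
    using assms by simp
  have "\<exists>L. submodular ?J L \<and>
    (\<forall>u. val ?J L u = 1 - (\<Prod>k\<in>K'. 1 - bump m (r k) (u (k, True)) * bump m (s k) (u (k, False))))"
    if "K' \<subseteq> K" for K'
    using finite_subset[OF that assms(1)] that
  proof (induction K' rule: finite_induct)
    case empty
    show ?case
      by (rule exI[of _ "[]"]) (simp add: submodular_Nil val_def)
  next
    case (insert k K')
    then obtain L where L: "submodular ?J L"
      "\<And>u. val ?J L u = 1 - (\<Prod>k\<in>K'. 1 - bump m (r k) (u (k, True)) * bump m (s k) (u (k, False)))"
      by auto
    have k: "(k, True) \<in> ?J" "(k, False) \<in> ?J" "r k > 0" "s k > 0"
      using insert.prems rs by auto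
    obtain M where M: "submodular ?J M" "supported k M" "\<And>u. val ?J M u = bump m (r k) (u (k, True))"
      using ex_lincomb_bump[OF J k(1,3), of m] by auto
    obtain N where N: "submodular ?J N" "supported k N" "\<And>u. val ?J N u = bump m (s k) (u (k, False))"
      using ex_lincomb_bump[OF J k(2,4), of m] by auto
    show ?case
      using insert.hyps L M N
      by (intro exI[of _ "disj (conv M N) L"])
        (auto simp: submodular_disj submodular_conv[OF _ _ M(2) N(2)] val_disj val_conv)
  qed
  then show ?thesis
    by blast
qed

lemma bump_bounds:
  assumes "c \<ge> 0" "v \<ge> 0"
  shows "0 \<le> bump m c v" "bump m c v \<le> 1"
  using assms by (auto simp: bump_def power_le_one)

lemma bump_le:
  assumes "c \<ge> 0" "v \<ge> 0"
  shows "bump m c v \<le> real m * exp (- (c * v))"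
  using Bernoulli_inequality[of "- exp (- (c * v))" m] assms by (simp add: bump_def)

lemma exp_ln_scaled: "m > 0 \<Longrightarrow> m * exp (- (ln m / A * v)) = m powr (1 - v / A)" for m :: real
  by (simp add: powr_def algebra_simps exp_diff exp_minus field_simps)

text \<open>For \<open>v > A\<close> the bound \<open>m powr (1 - v / A)\<close> decreases in
  \<open>m\<close>, so \<open>m = 2\<close> is the worst case. For \<open>v \<le> A\<close> the
  right-hand side is at least 1.\<close>

lemma bump_dominated:
  assumes A: "A > 0" and v: "v \<ge> 0" and m: "m \<ge> 2"
  shows "bump m (ln m / A) v \<le> 2 * exp (- (ln 2 / A * v))"
proof (cases "v / A \<le> 1")
  case True
  have "bump m (ln m / A) v \<le> 1"
    using A v m by (intro bump_bounds) auto
  also have "1 \<le> 2 powr (1 - v / A)"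
    using True by (intro ge_one_powr_ge_zero) auto
  finally show ?thesis
    by (simp only: exp_ln_scaled zero_less_numeral)
next
  case False
  have "bump m (ln m / A) v \<le> real m powr (1 - v / A)"
    using bump_le[of "ln m / A" v m] exp_ln_scaled[of "real m" A v] A v m by simp
  also have "\<dots> \<le> 2 powr (1 - v / A)"
    using False m by (intro powr_mono2') auto
  finally show ?thesis
    by (simp only: exp_ln_scaled zero_less_numeral)
qed

text \<open>Below the threshold, \<open>1 - w \<le> exp (- w)\<close> bounds the power by
  \<open>exp (- (m powr (1 - v / A)))\<close>; above it, Bernoulli's inequality gives the decay. At
  \<open>v = A\<close> the limit would be \<open>1 - exp (- 1)\<close>.\<close>

lemma bump_tendsto:
  assumes A: "A > 0" and v: "v \<ge> 0" "v \<noteq> A"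
  shows "(\<lambda>m. bump m (ln m / A) v) \<longlonglongrightarrow> of_bool (v < A)"
proof (cases "v < A")
  case True
  then have "1 - v / A > 0"
    using A by simp
  then have "filterlim (\<lambda>m. real m powr (1 - v / A)) at_top sequentially"
    by real_asymp
  then have lim: "(\<lambda>m. exp (- (real m powr (1 - v / A)))) \<longlonglongrightarrow> 0"
    by (intro filterlim_compose[OF exp_at_bot]) (simp add: filterlim_uminus_at_bot)
  have "(\<lambda>m. (1 - exp (- (ln m / A * v))) ^ m) \<longlonglongrightarrow> 0"
  proof (rule tendsto_sandwich[OF _ _ tendsto_const lim])
    show "\<forall>\<^sub>F m in sequentially. 0 \<le> (1 - exp (- (ln (real m) / A * v))) ^ m"
      using eventually_gt_at_top[of 0] by eventually_elim (use A v in auto)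
    show "\<forall>\<^sub>F m in sequentially. (1 - exp (- (ln (real m) / A * v))) ^ m \<le> exp (- (real m powr (1 - v / A)))"
      using eventually_gt_at_top[of 0]
    proof eventually_elim
      case (elim m)
      have "(1 - exp (- (ln (real m) / A * v))) ^ m \<le> exp (- exp (- (ln (real m) / A * v))) ^ m"
        using elim A v exp_ge_add_one_self[of "- exp (- (ln (real m) / A * v))"] by (intro power_mono) auto
      also have "\<dots> = exp (- (real m * exp (- (ln m / A * v))))"
        by (simp add: exp_of_nat_mult[symmetric])
      finally show ?case
        using exp_ln_scaled[of "real m" A v] elim by simp
    qed
  qed
  from tendsto_diff[OF tendsto_const this, of 1] True show ?thesis
    by (simp add: bump_def)
next
  case False
  with v A have "1 - v / A < 0"
    by simp
  then have lim: "(\<lambda>m. real m powr (1 - v / A)) \<longlonglongrightarrow> 0"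
    by real_asymp
  have "(\<lambda>m. bump m (ln m / A) v) \<longlonglongrightarrow> 0"
  proof (rule tendsto_sandwich[OF _ _ tendsto_const lim])
    show "\<forall>\<^sub>F m in sequentially. 0 \<le> bump m (ln m / A) v"
      using eventually_gt_at_top[of 0] by eventually_elim (use A v in \<open>auto intro!: bump_bounds\<close>)
    show "\<forall>\<^sub>F m in sequentially. bump m (ln m / A) v \<le> real m powr (1 - v / A)"
      using eventually_gt_at_top[of 0]
    proof eventually_elim
      case (elim m)
      then show ?case
        using bump_le[of "ln m / A" v m] exp_ln_scaled[of "real m" A v] A v by simp
    qed
  qed
  with False show ?thesis
    by simp
qed

lemma lens_integral_tendsto:
  fixes x y :: "'k \<Rightarrow> complex" and r s :: "'k \<Rightarrow> real"
  assumes K: "finite K" and rs: "\<And>k. k \<in> K \<Longrightarrow> r k > 0 \<and> s k > 0"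
  shows "(\<lambda>m. \<integral>z. 1 - (\<Prod>k\<in>K. 1 - bump m (ln m / (r k)\<^sup>2) ((dist z (x k))\<^sup>2) *
       bump m (ln m / (s k)\<^sup>2) ((dist z (y k))\<^sup>2)) \<partial>lborel)
    \<longlonglongrightarrow> measure lborel (\<Union>k\<in>K. ball (x k) (r k) \<inter> ball (y k) (s k))"
proof -
  define U where "U = (\<Union>k\<in>K. ball (x k) (r k) \<inter> ball (y k) (s k))"
  define \<theta> where "\<theta> = (\<lambda>m z k. bump m (ln (real m) / (r k)\<^sup>2) ((dist z (x k))\<^sup>2) *
       bump m (ln m / (s k)\<^sup>2) ((dist z (y k))\<^sup>2))"
  \<comment> \<open>The integrable majorant combines the union bound over \<open>K\<close> with the
    Gaussian bound for the bump around \<open>x k\<close>; the bump around \<open>y k\<close> is at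
    most 1.\<close>
  define w where "w = (\<lambda>z. \<Sum>k\<in>K. 2 * exp (- (ln 2 / (r k)\<^sup>2) * (dist z (x k))\<^sup>2))"
  have \<theta>0: "0 \<le> \<theta> m z k" "\<theta> m z k \<le> 1" if "m \<ge> 2" for m z k
    unfolding \<theta>_def using that by (auto intro!: mult_nonneg_nonneg mult_le_one bump_bounds)
  have \<theta>w: "\<theta> m z k \<le> 2 * exp (- (ln 2 / (r k)\<^sup>2) * (dist z (x k))\<^sup>2)" if "m \<ge> 2" "k \<in> K" for m z k
  proof -
    have "\<theta> m z k \<le> bump m (ln m / (r k)\<^sup>2) ((dist z (x k))\<^sup>2)"
      unfolding \<theta>_def using that by (intro mult_right_le_one_le bump_bounds) auto
    also have "\<dots> \<le> 2 * exp (- (ln 2 / (r k)\<^sup>2 * (dist z (x k))\<^sup>2))"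
      using that rs[of k] by (intro bump_dominated) auto
    finally show ?thesis by simp
  qed
  have [measurable]: "(\<lambda>z. 1 - (\<Prod>k\<in>K. 1 - \<theta> m z k)) \<in> borel_measurable lborel" for m
    unfolding \<theta>_def bump_def by measurable
  have U: "U \<in> sets lborel"
    unfolding U_def by (auto intro!: borel_open)
  \<comment> \<open>The bumps converge to the indicators off the bounding circles, which are
    finitely many null sets.\<close>
  have null: "AE z in lborel. \<forall>k\<in>K. z \<notin> sphere (x k) (r k) \<and> z \<notin> sphere (y k) (s k)"
  proof -
    have "AE z in lborel. z \<notin> sphere a d" for a :: complex and d
      using negligible_sphere[of a d]
      by (intro AE_not_in) (auto simp: null_sets_completion_iff negligible_iff_null_sets)
    then show ?thesis
      using K by (simp add: AE_finite_all)
  qed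
  \<comment> \<open>The shift by 2 provides the hypothesis \<open>m \<ge> 2\<close> of the
    domination for every member of the sequence.\<close>
  have "(\<lambda>m. \<integral>z. 1 - (\<Prod>k\<in>K. 1 - \<theta> (m + 2) z k) \<partial>lborel) \<longlonglongrightarrow> (\<integral>z. indicator U z \<partial>lborel)"
  proof (rule integral_dominated_convergence[where w = w])
    show "integrable lborel w"
      unfolding w_def
    proof (intro Bochner_Integration.integrable_sum integrable_mult_right)
      fix k assume "k \<in> K"
      then have "ln 2 / (r k)\<^sup>2 > 0"
        using rs[of k] by simp
      from has_bochner_integral_gaussian_complex[OF this, of "x k"]
      show "integrable lborel (\<lambda>z. exp (- (ln 2 / (r k)\<^sup>2) * (dist z (x k))\<^sup>2))"
        by (auto simp: has_bochner_integral_iff)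
    qed
    show "AE z in lborel. norm (1 - (\<Prod>k\<in>K. 1 - \<theta> (m + 2) z k)) \<le> w z" for m
    proof (rule AE_I2)
      fix z
      have "1 - (\<Prod>k\<in>K. 1 - \<theta> (m + 2) z k) \<le> (\<Sum>k\<in>K. \<theta> (m + 2) z k)"
        using Weierstrass_prod_ineq[of K "\<theta> (m + 2) z"] \<theta>0[of "m + 2" z] by auto
      also have "\<dots> \<le> w z"
        unfolding w_def using \<theta>w[of "m + 2"] by (intro sum_mono) auto
      finally have "1 - (\<Prod>k\<in>K. 1 - \<theta> (m + 2) z k) \<le> w z" .
      moreover have "(\<Prod>k\<in>K. 1 - \<theta> (m + 2) z k) \<le> 1"
        using \<theta>0[of "m + 2" z] by (intro prod_le_1) auto
      ultimately show "norm (1 - (\<Prod>k\<in>K. 1 - \<theta> (m + 2) z k)) \<le> w z"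
        by simp
    qed
    show "AE z in lborel. (\<lambda>m. 1 - (\<Prod>k\<in>K. 1 - \<theta> (m + 2) z k)) \<longlonglongrightarrow> indicator U z"
      using null
    proof eventually_elim
      case (elim z)
      have "(\<lambda>m. \<theta> m z k) \<longlonglongrightarrow> of_bool (z \<in> ball (x k) (r k) \<inter> ball (y k) (s k))" if "k \<in> K" for k
      proof -
        have r0: "r k > 0" "s k > 0"
          using rs[OF that] by auto
        have "dist z (x k) \<noteq> r k" "dist z (y k) \<noteq> s k"
          using elim that by (auto simp: dist_commute)
        then have ne: "(dist z (x k))\<^sup>2 \<noteq> (r k)\<^sup>2" "(dist z (y k))\<^sup>2 \<noteq> (s k)\<^sup>2"
          using r0 by (auto simp: power2_eq_iff_nonneg)
        have lt: "d\<^sup>2 < e\<^sup>2 \<longleftrightarrow> d < e" if "0 \<le> d" "0 < e" for d e :: real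
          using that by (meson less_imp_le power_strict_mono power2_less_imp_less zero_less_numeral)
        have "(\<lambda>m. \<theta> m z k) \<longlonglongrightarrow> of_bool ((dist z (x k))\<^sup>2 < (r k)\<^sup>2) * of_bool ((dist z (y k))\<^sup>2 < (s k)\<^sup>2)"
          unfolding \<theta>_def
          using ne r0 by (intro tendsto_mult bump_tendsto) simp_all
        moreover have "of_bool ((dist z (x k))\<^sup>2 < (r k)\<^sup>2) * of_bool ((dist z (y k))\<^sup>2 < (s k)\<^sup>2)
          = (of_bool (z \<in> ball (x k) (r k) \<inter> ball (y k) (s k)) :: real)"
          using r0 by (simp add: lt dist_commute)
        ultimately show ?thesis
          by simp
      qed
      then have "(\<lambda>m. 1 - (\<Prod>k\<in>K. 1 - \<theta> (m + 2) z k)) \<longlonglongrightarrow>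
          1 - (\<Prod>k\<in>K. 1 - of_bool (z \<in> ball (x k) (r k) \<inter> ball (y k) (s k)))"
        by (intro tendsto_intros LIMSEQ_ignore_initial_segment)
      moreover have "1 - (\<Prod>k\<in>K. 1 - of_bool (z \<in> ball (x k) (r k) \<inter> ball (y k) (s k))) = (indicator U z :: real)"
      proof (cases "z \<in> U")
        case True
        then obtain k where "k \<in> K" "z \<in> ball (x k) (r k) \<inter> ball (y k) (s k)"
          by (auto simp: U_def)
        then have "(\<Prod>k\<in>K. 1 - of_bool (z \<in> ball (x k) (r k) \<inter> ball (y k) (s k))) = (0 :: real)"
          using K by (intro prod_zero) auto
        then show ?thesis
          using True by simp
      next
        case False
        then have "(\<Prod>k\<in>K. 1 - of_bool (z \<in> ball (x k) (r k) \<inter> ball (y k) (s k))) = (1 :: real)"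
          by (intro prod.neutral) (auto simp: U_def)
        then show ?thesis
          using False by simp
      qed
      ultimately show ?case
        by simp
    qed
  qed (use U in auto)
  then have "(\<lambda>m. \<integral>z. 1 - (\<Prod>k\<in>K. 1 - \<theta> m z k) \<partial>lborel) \<longlonglongrightarrow> (\<integral>z. indicator U z \<partial>lborel)"
    by (rule LIMSEQ_offset)
  then show ?thesis
    using U unfolding \<theta>_def U_def by simp
qed

theorem measure_lens_union_mono:
  fixes x y x' y' :: "'k \<Rightarrow> complex" and r s :: "'k \<Rightarrow> real"
  assumes K: "finite K" and rs: "\<And>k. k \<in> K \<Longrightarrow> r k > 0 \<and> s k > 0"
    and rigid: "\<And>k. k \<in> K \<Longrightarrow> dist (x k) (y k) = dist (x' k) (y' k)"
    and xx: "\<And>k l. k \<in> K \<Longrightarrow> l \<in> K \<Longrightarrow> dist (x k) (x l) \<le> dist (x' k) (x' l)"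
    and xy: "\<And>k l. k \<in> K \<Longrightarrow> l \<in> K \<Longrightarrow> dist (x k) (y l) \<le> dist (x' k) (y' l)"
    and yy: "\<And>k l. k \<in> K \<Longrightarrow> l \<in> K \<Longrightarrow> dist (y k) (y l) \<le> dist (y' k) (y' l)"
  shows "measure lborel (\<Union>k\<in>K. ball (x k) (r k) \<inter> ball (y k) (s k))
       \<le> measure lborel (\<Union>k\<in>K. ball (x' k) (r k) \<inter> ball (y' k) (s k))"
proof (rule LIMSEQ_le[OF lens_integral_tendsto[OF K rs] lens_integral_tendsto[OF K rs]])
  define P where "P = (\<lambda>(k, b). if b then x k else y k)"
  define Q where "Q = (\<lambda>(k, b). if b then x' k else y' k)"
  let ?J = "K \<times> (UNIV :: bool set)"
  show "\<exists>N. \<forall>m\<ge>N. (\<integral>z. 1 - (\<Prod>k\<in>K. 1 - bump m (ln m / (r k)\<^sup>2) ((dist z (x k))\<^sup>2) *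
       bump m (ln m / (s k)\<^sup>2) ((dist z (y k))\<^sup>2)) \<partial>lborel)
     \<le> (\<integral>z. 1 - (\<Prod>k\<in>K. 1 - bump m (ln m / (r k)\<^sup>2) ((dist z (x' k))\<^sup>2) *
       bump m (ln m / (s k)\<^sup>2) ((dist z (y' k))\<^sup>2)) \<partial>lborel)"
  \<comment> \<open>From \<open>m = 2\<close> on, \<open>ln m\<close> is positive, and so are all
    the rates of the bumps.\<close>
  proof (intro exI[of _ 2] allI impI)
    fix m :: nat assume m: "2 \<le> m"
    obtain L where L: "submodular ?J L"
      "\<And>u. val ?J L u = 1 - (\<Prod>k\<in>K. 1 - bump m (ln m / (r k)\<^sup>2) (u (k, True)) * bump m (ln m / (s k)\<^sup>2) (u (k, False)))"
      using ex_lincomb_lenses[OF K, of "\<lambda>k. ln m / (r k)\<^sup>2" "\<lambda>k. ln m / (s k)\<^sup>2" m] m rs by force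
    have "(\<integral>z. lincomb L (expo ?J (\<lambda>j. (dist z (P j))\<^sup>2)) \<partial>lborel)
       \<le> (\<integral>z. lincomb L (expo ?J (\<lambda>j. (dist z (Q j))\<^sup>2)) \<partial>lborel)"
    proof (rule integral_lincomb_expo_mono)
      show "admissible ?J L"
        using L by (simp add: submodular_def)
      fix i j assume ij: "i \<in> ?J" "j \<in> ?J"
      show "dist (P i) (P j) \<le> dist (Q i) (Q j)"
        using ij xx xy yy by (auto simp: P_def Q_def) (metis dist_commute)
      fix u :: "'k \<times> bool \<Rightarrow> real"
      assume ne: "dist (P i) (P j) \<noteq> dist (Q i) (Q j)" and u: "\<And>j. 0 \<le> u j"
      \<comment> \<open>The two centres of one lens keep their distance, so a changed distance
        belongs to different lenses.\<close>
      have "fst i \<noteq> fst j"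
        using ne rigid ij by (auto simp: P_def Q_def dist_commute split: if_splits prod.splits)
      then show "lincomb L (\<lambda>l. l i * l j * expo ?J u l) \<le> 0"
        using L u unfolding submodular_def val2_def by blast
    qed
    then show "(\<integral>z. 1 - (\<Prod>k\<in>K. 1 - bump m (ln m / (r k)\<^sup>2) ((dist z (x k))\<^sup>2) *
         bump m (ln m / (s k)\<^sup>2) ((dist z (y k))\<^sup>2)) \<partial>lborel)
       \<le> (\<integral>z. 1 - (\<Prod>k\<in>K. 1 - bump m (ln m / (r k)\<^sup>2) ((dist z (x' k))\<^sup>2) *
         bump m (ln m / (s k)\<^sup>2) ((dist z (y' k))\<^sup>2)) \<partial>lborel)"
      by (simp add: val_def[symmetric] L(2) P_def Q_def)
  qed
qed

section \<open>Symmetric slender adornments\<close>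

lemma reflect_line_fixed [simp]:
  assumes "x \<noteq> y"
  shows "reflect_line x y x = x" "reflect_line x y y = y"
  using assms by (auto simp: reflect_line_def)

lemma reflect_line_involution: "x \<noteq> y \<Longrightarrow> reflect_line x y (reflect_line x y z) = z"
  by (simp add: reflect_line_def)

lemma dist_reflect_line:
  assumes "x \<noteq> y"
  shows "dist (reflect_line x y z) (reflect_line x y w) = dist z w"
proof -
  have "reflect_line x y z - reflect_line x y w = (y - x) * cnj ((z - w) / (y - x))"
    by (simp add: reflect_line_def algebra_simps diff_divide_distrib)
  then have "norm (reflect_line x y z - reflect_line x y w) = norm (y - x) * (norm (z - w) / norm (y - x))"
    by (simp only: norm_mult complex_mod_cnj norm_divide)
  then show ?thesis
    using assms by (simp add: dist_norm)
qed

lemma dist_reflect_line_ends: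
  assumes "x \<noteq> y"
  shows "dist (reflect_line x y z) x = dist z x" "dist (reflect_line x y z) y = dist z y"
  using dist_reflect_line[OF assms, of z x] dist_reflect_line[OF assms, of z y] assms by auto

lemma continuous_on_reflect_line: "x \<noteq> y \<Longrightarrow> continuous_on A (reflect_line x y)"
  unfolding reflect_line_def by (intro continuous_intros) auto

text \<open>In the coordinate that sends \<open>x\<close> to 0 and \<open>y\<close> to 1, the two
  distances determine the real part and the square of the imaginary part.\<close>

lemma dist_ends_eq:
  assumes "x \<noteq> y" "dist z x = dist w x" "dist z y = dist w y"
  shows "z = w \<or> z = reflect_line x y w"
proof -
  define a where "a = (z - x) / (y - x)"
  define b where "b = (w - x) / (y - x)"
  have z: "z = x + (y - x) * a" and w: "w = x + (y - x) * b"
    using assms(1) by (auto simp: a_def b_def)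
  have "z - y = (y - x) * (a - 1)" "w - y = (y - x) * (b - 1)"
    unfolding z w by (auto simp: algebra_simps)
  then have "cmod a = cmod b" "cmod (a - 1) = cmod (b - 1)"
    using assms by (auto simp: dist_norm norm_mult z w)
  then have "(cmod a)\<^sup>2 = (cmod b)\<^sup>2" "(cmod (a - 1))\<^sup>2 = (cmod (b - 1))\<^sup>2"
    by simp_all
  then have "Re a = Re b" "(Im a)\<^sup>2 = (Im b)\<^sup>2"
    unfolding cmod_power2 by (auto simp: power2_eq_square algebra_simps)
  then have "a = b \<or> a = cnj b"
    by (auto simp: complex_eq_iff power2_eq_iff)
  then show ?thesis
    using assms(1) by (auto simp: z w reflect_line_def)
qed

lemma reflect_line_fixed_segment:
  assumes "x \<noteq> y" "reflect_line x y z = z" "dist z x \<le> dist x y" "dist z y \<le> dist x y"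
  shows "z \<in> closed_segment x y"
proof -
  define a where "a = (z - x) / (y - x)"
  have z: "z = x + (y - x) * a"
    using assms(1) by (auto simp: a_def)
  have "cnj a = a"
    using assms(1,2) by (simp add: z reflect_line_def)
  then have a: "a = of_real (Re a)"
    by (simp add: complex_eq_iff)
  have "z - y = (y - x) * (a - 1)"
    unfolding z by (auto simp: algebra_simps)
  then have "cmod a \<le> 1" "cmod (a - 1) \<le> 1"
    using assms by (auto simp: dist_norm norm_mult z norm_minus_commute)
  moreover have "cmod a = \<bar>Re a\<bar>" "cmod (a - 1) = \<bar>Re a - 1\<bar>"
    using a by (metis norm_of_real, metis norm_of_real of_real_1 of_real_diff)
  ultimately have "0 \<le> Re a" "Re a \<le> 1"
    by auto
  moreover have "z = (1 - Re a) *\<^sub>R x + Re a *\<^sub>R y"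
    unfolding z by (subst a) (simp add: scaleR_conv_of_real algebra_simps)
  ultimately show ?thesis
    by (auto simp: in_segment)
qed

lemma frontier_reflect_line:
  assumes "x \<noteq> y" "closed S" "reflect_line x y ` S = S" "z \<in> frontier S"
  shows "reflect_line x y z \<in> frontier S"
proof -
  let ?R = "reflect_line x y"
  have inv: "?R (?R w) = w" for w
    using assms(1) by (rule reflect_line_involution)
  have "?R ` (- S) \<subseteq> - S"
    using assms(3) inv by (metis ComplD ComplI image_eqI image_subsetI)
  have "?R ` closure (- S) \<subseteq> closure (- S)"
    by (rule image_closure_subset[OF continuous_on_reflect_line[OF assms(1)] closed_closure])
      (use \<open>?R ` (- S) \<subseteq> - S\<close> closure_subset in blast)
  moreover have "z \<in> S" "z \<in> closure (- S)"
    using assms(2,4) by (auto simp: frontier_closures)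
  ultimately show ?thesis
    using assms(2,3) by (auto simp: frontier_closures)
qed

section \<open>Comparability of frontier points\<close>

text \<open>If a point and its mirror image had different parameters, monotonicity would make both
  distances constant between them. The side would then take at most two values on an interval,
  contradicting injectivity. So each point is its own mirror image.\<close>

lemma slender_side_fixed:
  assumes xy: "x \<noteq> y" and g: "arc g" "pathstart g = x" "pathfinish g = y" "slender_side x y g"
    and inv: "reflect_line x y ` path_image g \<subseteq> path_image g"
  shows "path_image g \<subseteq> closed_segment x y"
proof
  fix p assume "p \<in> path_image g"
  then obtain s where s: "s \<in> {0..1}" "p = g s"
    by (auto simp: path_image_def)
  obtain t where t: "t \<in> {0..1}" "reflect_line x y p = g t"
    using inv \<open>p \<in> path_image g\<close> unfolding path_image_def by blast
  have inj: "inj_on g {0..1}"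
    using g(1) by (simp add: arc_def)
  have d: "dist (g t) x = dist (g s) x" "dist (g t) y = dist (g s) y"
    using dist_reflect_line_ends[OF xy, of p] s t by auto
  have "s = t"
  proof (rule ccontr)
    assume "s \<noteq> t"
    define a b where "a = min s t" and "b = max s t"
    have ab: "a < b" "a \<in> {0..1}" "b \<in> {0..1}"
      using \<open>s \<noteq> t\<close> s t by (auto simp: a_def b_def)
    have dab: "dist (g a) x = dist p x" "dist (g a) y = dist p y"
      "dist (g b) x = dist p x" "dist (g b) y = dist p y"
      using d s by (auto simp: a_def b_def min_def max_def)
    have "g ` {a..b} \<subseteq> {p, reflect_line x y p}"
    proof (rule image_subsetI)
      fix u assume u: "u \<in> {a..b}"
      then have u1: "u \<in> {0..1}" "a \<le> u" "u \<le> b"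
        using ab by auto
      have "dist (g u) x = dist p x" "dist (g u) y = dist p y"
        using g(4) u1 ab dab unfolding slender_side_def by (metis order_antisym)+
      then show "g u \<in> {p, reflect_line x y p}"
        using dist_ends_eq[OF xy] by blast
    qed
    then have "finite (g ` {a..b})"
      by (rule finite_subset) simp
    moreover have "inj_on g {a..b}"
      using inj by (rule inj_on_subset) (use ab in auto)
    ultimately have "finite {a..b}"
      by (rule finite_imageD)
    with ab show False
      using infinite_Icc by blast
  qed
  then have "reflect_line x y p = p"
    using s t by simp
  moreover have "dist p x \<le> dist x y" "dist p y \<le> dist x y"
  proof -
    have "dist (g s) x \<le> dist (g 1) x" "dist (g s) y \<le> dist (g 0) y"
      using g(4) s unfolding slender_side_def by auto
    then show "dist p x \<le> dist x y" "dist p y \<le> dist x y"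
      using g s by (auto simp: pathstart_def pathfinish_def dist_commute)
  qed
  ultimately show "p \<in> closed_segment x y"
    by (intro reflect_line_fixed_segment xy)
qed

text \<open>The intermediate value theorem for the distance from \<open>x\<close>. It gives two
  paths inside the base a common point other than the ends.\<close>

lemma path_midpoint:
  fixes x y :: "'a :: euclidean_space"
  assumes "path g" "pathstart g = x" "pathfinish g = y" "path_image g \<subseteq> closed_segment x y"
  shows "midpoint x y \<in> path_image g"
proof -
  have "connected ((\<lambda>z. dist z x) ` path_image g)"
    by (intro connected_continuous_image connected_path_image assms continuous_intros)
  moreover have "0 \<in> (\<lambda>z. dist z x) ` path_image g" "dist y x \<in> (\<lambda>z. dist z x) ` path_image g"
    using assms pathstart_in_path_image[of g] pathfinish_in_path_image[of g] by force+
  ultimately have "dist y x / 2 \<in> (\<lambda>z. dist z x) ` path_image g"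
    by (rule connectedD_interval) auto
  then obtain p where p: "p \<in> path_image g" "dist p x = dist y x / 2"
    by auto
  then have "p \<in> closed_segment x y"
    using assms(4) by blast
  then obtain u where u: "0 \<le> u" "p = (1 - u) *\<^sub>R x + u *\<^sub>R y"
    by (auto simp: in_segment)
  have "p - x = u *\<^sub>R (y - x)"
    unfolding u by (simp add: algebra_simps)
  then have "u * dist y x = dist y x / 2"
    using p u by (simp add: dist_norm)
  then consider "x = y" | "u = 1 / 2"
    by fastforce
  then have "p = midpoint x y"
  proof cases
    case 1
    then show ?thesis
      by (simp add: u(2) midpoint_def scaleR_add_left[symmetric])
  next
    case 2
    then show ?thesis
      unfolding u(2) 2 by (simp add: midpoint_def scaleR_add_right)
  qed
  with p show ?thesis
    by simp
qed

text \<open>Distances to the ends are monotone along each side, and reflection swaps the sides, so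
  any two frontier points are comparable.\<close>
lemma frontier_comparable:
  assumes sides: "adornment_sides S x y g1 g2"
    and sl: "slender_side x y g1" "slender_side x y g2"
    and sym: "symmetric_adornment S x y"
    and pq: "p \<in> frontier S" "q \<in> frontier S"
  shows "\<not> (dist p x < dist q x \<and> dist p y < dist q y)"
proof -
  let ?R = "reflect_line x y"
  have xy: "x \<noteq> y" and F: "path_image g1 \<union> path_image g2 = frontier S"
    and I: "path_image g1 \<inter> path_image g2 = {x, y}" and cl: "closed S"
    and g1: "arc g1" "pathstart g1 = x" "pathfinish g1 = y"
    and g2: "arc g2" "pathstart g2 = x" "pathfinish g2 = y"
    using sides compact_imp_closed unfolding adornment_sides_def by blast+
  have RF: "?R z \<in> frontier S" if "z \<in> frontier S" for z
    using sym that unfolding symmetric_adornment_def by (intro frontier_reflect_line xy cl)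
  have same: "\<not> (dist p x < dist q x \<and> dist p y < dist q y)"
    if g: "slender_side x y g" "p \<in> path_image g" "q \<in> path_image g" for g p q
  proof -
    obtain s t where st: "s \<in> {0..1}" "p = g s" "t \<in> {0..1}" "q = g t"
      using g(2,3) unfolding path_image_def by blast
    have "s \<le> t \<Longrightarrow> dist q y \<le> dist p y" "t \<le> s \<Longrightarrow> dist q x \<le> dist p x"
      using g(1) st unfolding slender_side_def by blast+
    then show ?thesis
      by linarith
  qed
  \<comment> \<open>The reflected open side \<open>C\<close> is connected and avoids
    \<open>x\<close> and \<open>y\<close>, the only common points of the two closed sides, so it
    lies in one of them.\<close>
  have alt: "?R ` path_image g \<subseteq> path_image g1 \<or> ?R ` path_image g \<subseteq> path_image g2"
    if g: "arc g" "pathstart g = x" "pathfinish g = y" "path_image g \<subseteq> frontier S" for g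
  proof -
    define C where "C = ?R ` g ` {0<..<1}"
    have cont: "continuous_on {0..1} g" and inj: "inj_on g {0..1}"
      using g by (auto simp: arc_def path_def)
    have ends: "g 0 = x" "g 1 = y"
      using g by (auto simp: pathstart_def pathfinish_def)
    have "connected C"
      unfolding C_def
      by (intro connected_continuous_image continuous_on_reflect_line xy continuous_on_subset[OF cont]) auto
    moreover have "C \<subseteq> path_image g1 \<union> path_image g2"
    proof -
      have "g ` {0<..<1} \<subseteq> path_image g"
        unfolding path_image_def by (rule image_mono) auto
      then show ?thesis
        using g(4) RF unfolding C_def F by blast
    qed
    moreover have "path_image g1 \<inter> path_image g2 \<inter> C = {}"
    proof -
      have ne: "?R (g t) \<notin> {x, y}" if t: "t \<in> {0<..<1}" for t
      proof
        assume "?R (g t) \<in> {x, y}"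
        then have "?R (?R (g t)) \<in> ?R ` {x, y}"
          by (rule imageI)
        then have "g t \<in> {x, y}"
          by (simp only: reflect_line_involution[OF xy] reflect_line_fixed[OF xy] image_insert image_empty)
        then have "g t = g 0 \<or> g t = g 1"
          unfolding ends by blast
        moreover have "t \<in> {0..1}" "0 \<in> {0..1::real}" "1 \<in> {0..1::real}"
          using t by auto
        ultimately have "t = 0 \<or> t = 1"
          using inj by (meson inj_onD)
        then show False
          using t by auto
      qed
      have "w \<notin> {x, y}" if w: "w \<in> C" for w
      proof -
        obtain t where t: "t \<in> {0<..<1}" and "w = ?R (g t)"
          using w unfolding C_def by blast
        then show ?thesis
          using ne[OF t] by (simp only: not_False_eq_True)
      qed
      then show ?thesis
        unfolding I by (intro equals0I) (elim IntE, simp only:)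
    qed
    ultimately have "path_image g1 \<inter> C = {} \<or> path_image g2 \<inter> C = {}"
      by (intro connected_closedD closed_path_image arc_imp_path g1 g2)
    then have "C \<subseteq> path_image g1 \<or> C \<subseteq> path_image g2"
      using \<open>C \<subseteq> path_image g1 \<union> path_image g2\<close> by blast
    moreover have "?R ` path_image g \<subseteq> C \<union> {x, y}"
    proof -
      have "{0..1} = {0<..<1} \<union> {0, 1 :: real}"
        by auto
      then show ?thesis
        unfolding C_def path_image_def using ends xy by (simp add: image_Un)
    qed
    moreover have "{x, y} \<subseteq> path_image g1" "{x, y} \<subseteq> path_image g2"
      unfolding I[symmetric] by auto
    ultimately show ?thesis
      by (meson Un_least order_trans)
  qed
  \<comment> \<open>If each side were mapped into itself, both would lie in the base and share its
    midpoint.\<close>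
  have "?R ` path_image g1 \<subseteq> path_image g2 \<or> ?R ` path_image g2 \<subseteq> path_image g1"
  proof (rule ccontr)
    assume "\<not> ?thesis"
    moreover have "path_image g1 \<subseteq> frontier S" "path_image g2 \<subseteq> frontier S"
      unfolding F[symmetric] by auto
    ultimately have "?R ` path_image g1 \<subseteq> path_image g1" "?R ` path_image g2 \<subseteq> path_image g2"
      using alt[OF g1] alt[OF g2] by metis+
    then have "path_image g1 \<subseteq> closed_segment x y" "path_image g2 \<subseteq> closed_segment x y"
      using slender_side_fixed[OF xy g1 sl(1)] slender_side_fixed[OF xy g2 sl(2)] by blast+
    then have "midpoint x y \<in> path_image g1 \<inter> path_image g2"
      by (intro IntI path_midpoint arc_imp_path g1 g2)
    then show False
      using xy unfolding I by auto
  qed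
  then consider "?R ` path_image g1 \<subseteq> path_image g2" | "?R ` path_image g2 \<subseteq> path_image g1"
    by blast
  \<comment> \<open>Replacing a point by its mirror image keeps both distances, so \<open>p\<close>
    and \<open>q\<close> may be moved to a common side.\<close>
  then have "\<exists>g p' q'. slender_side x y g \<and> p' \<in> path_image g \<and> q' \<in> path_image g \<and>
      p' \<in> {p, ?R p} \<and> q' \<in> {q, ?R q}"
  proof cases
    case 1
    then have "p \<in> path_image g2 \<or> ?R p \<in> path_image g2" "q \<in> path_image g2 \<or> ?R q \<in> path_image g2"
      using pq unfolding F[symmetric] by auto
    with sl(2) show ?thesis
      by (intro exI[of _ g2]) auto
  next
    case 2
    then have "p \<in> path_image g1 \<or> ?R p \<in> path_image g1" "q \<in> path_image g1 \<or> ?R q \<in> path_image g1"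
      using pq unfolding F[symmetric] by auto
    with sl(1) show ?thesis
      by (intro exI[of _ g1]) auto
  qed
  then obtain g p' q' where g: "slender_side x y g" "p' \<in> path_image g" "q' \<in> path_image g"
    and pq': "p' \<in> {p, ?R p}" "q' \<in> {q, ?R q}"
    by blast
  have "dist p' x = dist p x" "dist p' y = dist p y" "dist q' x = dist q x" "dist q' y = dist q y"
    using pq' dist_reflect_line_ends[OF xy] by auto
  with same[OF g] show ?thesis
    by simp
qed

section \<open>Adornments as unions of lenses\<close>

text \<open>The open lens is connected, meets the base and avoids the frontier, so it lies in
  \<open>S\<close>, and so does its closure. In the degenerate cases \<open>z\<close> lies on the
  base.\<close>

lemma lens_subset_slender:
  assumes sides: "adornment_sides S x y g1 g2"
    and cmp: "\<And>q. q \<in> frontier S \<Longrightarrow> \<not> (dist q x < a \<and> dist q y < b)"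
    and z: "dist z x \<le> a" "dist z y \<le> b"
  shows "z \<in> S"
proof -
  note S = sides[unfolded adornment_sides_def]
  have xy: "x \<noteq> y" and seg: "closed_segment x y \<subseteq> S" and cl: "closed S"
    using S by (auto simp: compact_imp_closed)
  define d where "d = dist x y"
  have d: "d > 0"
    using xy by (simp add: d_def)
  consider "a + b \<le> d" | "a \<le> 0" | "b \<le> 0" | "a > 0" "b > 0" "a + b > d"
    by linarith
  then show ?thesis
  proof cases
    case 1
    then have "dist x y = dist x z + dist z y"
      using z dist_triangle[of x y z] by (simp add: d_def dist_commute)
    then have "z \<in> closed_segment x y"
      by (simp add: between[symmetric] between_mem_segment[symmetric])
    then show ?thesis
      using seg by blast
  next
    case 2
    then have "z = x"
      using z zero_le_dist[of z x] by (metis dist_eq_0_iff order_antisym order_trans)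
    then show ?thesis
      using seg by auto
  next
    case 3
    then have "z = y"
      using z zero_le_dist[of z y] by (metis dist_eq_0_iff order_antisym order_trans)
    then show ?thesis
      using seg by auto
  next
    case 4
    define O' where "O' = ball x a \<inter> ball y b"
    have "1 < (a + b) / d"
      using 4 d by simp
    then have "max 0 (1 - b / d) < min 1 (a / d)"
      using 4 d by (simp add: add_divide_distrib)
    \<comment> \<open>Since \<open>a + b > d\<close>, some point of the base is closer than
      \<open>a\<close> to \<open>x\<close> and closer than \<open>b\<close> to \<open>y\<close>;
      \<open>s\<close> is its parameter.\<close>
    then obtain s where s: "max 0 (1 - b / d) < s" "s < min 1 (a / d)"
      using dense by blast
    then have s': "0 \<le> s" "s \<le> 1" "s * d < a" "(1 - s) * d < b"
      using d by (auto simp: field_simps)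
    define m where "m = (1 - s) *\<^sub>R x + s *\<^sub>R y"
    have "x - m = s *\<^sub>R (x - y)" "y - m = (1 - s) *\<^sub>R (y - x)"
      by (auto simp: m_def algebra_simps)
    then have "dist x m = s * d" "dist y m = (1 - s) * d"
      using s' by (auto simp: dist_norm d_def norm_minus_commute)
    then have mO: "m \<in> O'"
      using s' by (simp add: O'_def)
    moreover have "m \<in> S"
      using s' unfolding m_def by (intro subsetD[OF seg]) (auto simp: in_segment)
    moreover have "connected O'"
      unfolding O'_def by (intro convex_connected convex_Int convex_ball)
    moreover have "O' \<inter> frontier S = {}"
      using cmp by (auto simp: O'_def dist_commute)
    ultimately have "O' \<subseteq> S"
      using connected_Int_frontier[of O' S] by blast
    then have "closure O' \<subseteq> S"
      using cl by (rule closure_minimal)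
    moreover have "closure O' = closure (ball x a) \<inter> closure (ball y b)"
      unfolding O'_def by (rule closure_Int_convex) (use mO in \<open>auto simp: O'_def rel_interior_open\<close>)
    ultimately show ?thesis
      using 4 z by (auto simp: dist_commute)
  qed
qed

text \<open>If no lens along \<open>g1\<close> contained \<open>z\<close>, connectedness of the
  parameter interval would give a frontier point strictly closer than \<open>z\<close> to both ends.
  Leaving \<open>S\<close> from \<open>z\<close> gives a frontier point at least as far as
  \<open>z\<close> from both, against comparability.\<close>

lemma slender_subset_lenses:
  assumes sides: "adornment_sides S x y g1 g2"
    and cmp: "\<And>p q. p \<in> frontier S \<Longrightarrow> q \<in> frontier S \<Longrightarrow> \<not> (dist p x < dist q x \<and> dist p y < dist q y)"
    and z: "z \<in> S"
  shows "\<exists>t\<in>{0..1}. dist z x \<le> dist (g1 t) x \<and> dist z y \<le> dist (g1 t) y"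
proof (rule ccontr)
  assume "\<not> ?thesis"
  then have neg: "dist (g1 t) x < dist z x \<or> dist (g1 t) y < dist z y" if "t \<in> {0..1}" for t
    using that by (meson not_le)
  have xy: "x \<noteq> y" and F: "path_image g1 \<subseteq> frontier S" and "bounded S"
    and g1: "arc g1" "pathstart g1 = x" "pathfinish g1 = y"
    using sides compact_imp_bounded unfolding adornment_sides_def by blast+
  have ends: "g1 0 = x" "g1 1 = y"
    using g1 by (auto simp: pathstart_def pathfinish_def)
  have cont: "continuous_on {0..1} g1"
    using g1 by (auto simp: arc_def path_def)
  define A where "A = {t\<in>{0..1}. dist z x \<le> dist (g1 t) x}"
  define B where "B = {t\<in>{0..1}. dist z y \<le> dist (g1 t) y}"
  have "z \<noteq> x" "z \<noteq> y"
    using neg[of 0] neg[of 1] ends by auto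
  have "closed A" "closed B"
    unfolding A_def B_def by (intro continuous_on_closed_Collect_le continuous_intros cont closed_real_atLeastAtMost)+
  moreover have "A \<inter> B \<inter> {0..1} = {}"
    using neg by (force simp: A_def B_def)
  moreover have "{0..1} \<subseteq> A \<union> B \<Longrightarrow> A \<inter> {0..1} = {} \<or> B \<inter> {0..1} = {}"
    using calculation by (intro connected_closedD) auto
  moreover have "A \<inter> {0..1} \<noteq> {}" if "1 \<in> A"
    using that by (auto intro!: exI[of _ 1] simp: disjoint_iff)
  moreover have "B \<inter> {0..1} \<noteq> {}" if "0 \<in> B"
    using that by (auto intro!: exI[of _ 0] simp: disjoint_iff)
  \<comment> \<open>Two disjoint closed sets, both nonempty, cannot cover the interval. If
    \<open>1 \<notin> A\<close> or \<open>0 \<notin> B\<close>, the end \<open>y\<close> or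
    \<open>x\<close> itself is the closer frontier point.\<close>
  ultimately have "1 \<notin> A \<or> 0 \<notin> B \<or> \<not> {0..1} \<subseteq> A \<union> B"
    by blast
  then have "\<exists>t\<in>{0..1}. dist (g1 t) x < dist z x \<and> dist (g1 t) y < dist z y"
  proof (elim disjE)
    assume "1 \<notin> A"
    then show ?thesis
      using ends \<open>z \<noteq> y\<close> by (intro bexI[of _ 1]) (auto simp: A_def)
  next
    assume "0 \<notin> B"
    then show ?thesis
      using ends \<open>z \<noteq> x\<close> by (intro bexI[of _ 0]) (auto simp: B_def)
  next
    assume "\<not> {0..1} \<subseteq> A \<union> B"
    then show ?thesis
      by (auto simp: A_def B_def not_le)
  qed
  then obtain t where t: "t \<in> {0..1}" "dist (g1 t) x < dist z x" "dist (g1 t) y < dist z y"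
    by blast
  then have gt: "g1 t \<in> frontier S"
    using F unfolding path_image_def by blast
  \<comment> \<open>Along the ray from \<open>z\<close> perpendicular to and away from the base both distances increase, so the
    frontier point where the ray leaves \<open>S\<close> cannot be compared with \<open>g1 t\<close>.\<close>
  obtain v where v: "v \<noteq> 0" "(z - x) \<bullet> v \<ge> 0" "(z - y) \<bullet> v \<ge> 0"
  proof -
    define v where "v = \<i> * (y - x)"
    have "v \<noteq> 0" "(y - x) \<bullet> v = 0"
      using xy by (auto simp: v_def inner_complex_def algebra_simps)
    moreover from this have "(z - y) \<bullet> v = (z - x) \<bullet> v"
      by (simp add: inner_diff_left)
    ultimately show ?thesis
      using that[of v] that[of "- v"] by (cases "(z - x) \<bullet> v \<ge> 0") auto
  qed
  have far: "dist w c \<le> dist (w + s *\<^sub>R v) c" if "(w - c) \<bullet> v \<ge> 0" "s \<ge> 0" for w c s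
  proof -
    have "w + s *\<^sub>R v - c = (w - c) + s *\<^sub>R v"
      by simp
    moreover have "(norm (d + s *\<^sub>R v))\<^sup>2 = (norm d)\<^sup>2 + 2 * s * (d \<bullet> v) + s\<^sup>2 * (v \<bullet> v)" for d
      unfolding power2_norm_eq_inner by (simp add: inner_simps inner_commute power2_eq_square algebra_simps)
    ultimately have "(dist (w + s *\<^sub>R v) c)\<^sup>2 = (dist w c)\<^sup>2 + 2 * s * ((w - c) \<bullet> v) + s\<^sup>2 * (v \<bullet> v)"
      by (simp only: dist_norm)
    also have "\<dots> \<ge> (dist w c)\<^sup>2"
      using that by simp
    finally show ?thesis
      by (rule power2_le_imp_le) simp
  qed
  define T where "T = (\<lambda>s. z + s *\<^sub>R v) ` {0..}"
  have "connected T"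
    unfolding T_def by (intro connected_continuous_image continuous_intros) auto
  moreover have "z \<in> T"
    unfolding T_def by (rule image_eqI[of _ _ 0]) auto
  moreover have "T - S \<noteq> {}"
  proof
    assume "T - S = {}"
    moreover obtain M where M: "\<And>w. w \<in> S \<Longrightarrow> norm w \<le> M"
      using \<open>bounded S\<close> by (auto simp: bounded_iff)
    ultimately have T: "norm w \<le> M" if "w \<in> T" for w
      using that by blast
    define s where "s = (M + norm z + 1) / norm v"
    have "M \<ge> 0"
      using M[OF z] norm_ge_zero[of z] by linarith
    then have "s \<ge> 0" "norm (s *\<^sub>R v) = M + norm z + 1"
      using v by (auto simp: s_def)
    moreover from this have "norm (z + s *\<^sub>R v) \<le> M"
      by (intro T) (auto simp: T_def)
    ultimately show False
      using norm_triangle_ineq2[of "s *\<^sub>R v" "- z"] by (simp add: add.commute)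
  qed
  ultimately obtain q where q: "q \<in> T" "q \<in> frontier S"
    using connected_Int_frontier[of T S] z by blast
  then have "dist z x \<le> dist q x" "dist z y \<le> dist q y"
    using v far by (auto simp: T_def)
  then show False
    using cmp[OF gt q(2)] t by linarith
qed

lemma slender_symmetric_eq_lenses:
  assumes "slender_adornment S x y" "symmetric_adornment S x y"
  obtains g :: "real \<Rightarrow> complex" where "continuous_on {0..1} g"
    "S = {z. \<exists>t\<in>{0..1}. dist z x \<le> dist (g t) x \<and> dist z y \<le> dist (g t) y}"
proof -
  obtain g1 g2 where sides: "adornment_sides S x y g1 g2"
    and sl: "slender_side x y g1" "slender_side x y g2"
    using assms(1) unfolding slender_adornment_def by blast
  note cmp = frontier_comparable[OF sides sl assms(2)]
  have F: "path_image g1 \<subseteq> frontier S" and arc: "arc g1"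
    using sides unfolding adornment_sides_def by blast+
  have "z \<in> S" if t: "t \<in> {0..1}" and z: "dist z x \<le> dist (g1 t) x" "dist z y \<le> dist (g1 t) y" for z t
  proof (rule lens_subset_slender[OF sides _ z])
    have "g1 t \<in> frontier S"
      using t F unfolding path_image_def by blast
    then show "\<not> (dist q x < dist (g1 t) x \<and> dist q y < dist (g1 t) y)" if "q \<in> frontier S" for q
      using cmp that by blast
  qed
  moreover have "\<exists>t\<in>{0..1}. dist z x \<le> dist (g1 t) x \<and> dist z y \<le> dist (g1 t) y" if "z \<in> S" for z
    using sides cmp that by (rule slender_subset_lenses)
  ultimately have "S = {z. \<exists>t\<in>{0..1}. dist z x \<le> dist (g1 t) x \<and> dist z y \<le> dist (g1 t) y}"
    by blast
  with arc show ?thesis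
    by (intro that[of g1]) (simp_all add: arc_def path_def)
qed

section \<open>Rigid motions and passage from finite to infinite unions\<close>

lemma bar_motion_lenses:
  assumes ne: "p i \<noteq> p (Suc i)" and d: "dist (q i) (q (Suc i)) = dist (p i) (p (Suc i))"
  shows "bar_motion p q i ` {z. \<exists>t\<in>T. dist z (p i) \<le> a t \<and> dist z (p (Suc i)) \<le> b t}
    = {z. \<exists>t\<in>T. dist z (q i) \<le> a t \<and> dist z (q (Suc i)) \<le> b t}"
proof -
  \<comment> \<open>The rotation factor of the motion. It has modulus 1 because the bar keeps its
    length, so the motion is an isometry of the plane carrying the ends of the bar to its new
    ends.\<close>
  define c where "c = (q (Suc i) - q i) / (p (Suc i) - p i)"
  have c: "cmod c = 1" "c \<noteq> 0"
    using assms by (auto simp: c_def norm_divide dist_norm norm_minus_commute)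
  have qc: "q (Suc i) = q i + (p (Suc i) - p i) * c"
    using ne by (simp add: c_def)
  have bm: "bar_motion p q i z = q i + (z - p i) * c" for z
    by (simp add: bar_motion_def c_def)
  have 1: "dist (bar_motion p q i z) (q i) = dist z (p i)" for z
    by (simp add: bm dist_norm norm_mult c)
  have "bar_motion p q i z - q (Suc i) = (z - p (Suc i)) * c" for z
    by (simp add: bm qc algebra_simps)
  then have 2: "dist (bar_motion p q i z) (q (Suc i)) = dist z (p (Suc i))" for z
    by (simp add: dist_norm norm_mult c)
  have "bar_motion p q i (p i + (w - q i) / c) = w" for w
    using c by (simp add: bm)
  then have "\<exists>z. w = bar_motion p q i z" for w
    by metis
  then show ?thesis
    using 1 2 by (auto simp: image_iff) metis
qed

text \<open>The larger of the two excesses is continuous in \<open>t\<close> and attains a positive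
  minimum, so one small enlargement of the radii works for all \<open>t\<close>.\<close>

lemma eventually_not_near_lenses:
  fixes a b :: "real \<Rightarrow> real" and z :: "'a :: metric_space"
  assumes cont: "continuous_on {0..1} a" "continuous_on {0..1} b"
    and z: "\<And>t. t \<in> {0..1} \<Longrightarrow> \<not> (dist z x \<le> a t \<and> dist z y \<le> b t)"
  shows "\<forall>\<^sub>F m in sequentially. \<forall>t\<in>{0..1}.
    \<not> (dist z x < a t + inverse (real (Suc m)) \<and> dist z y < b t + inverse (real (Suc m)))"
proof -
  define f where "f = (\<lambda>t. max (dist z x - a t) (dist z y - b t))"
  have "continuous_on {0..1} f"
    unfolding f_def by (intro continuous_intros cont)
  then obtain t0 where t0: "t0 \<in> {0..1}" "\<And>t. t \<in> {0..1} \<Longrightarrow> f t0 \<le> f t"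
    using continuous_attains_inf[of "{0..1::real}" f] by auto
  have "f t0 > 0"
    using z[OF t0(1)] by (auto simp: f_def)
  then have "\<forall>\<^sub>F m in sequentially. inverse (real (Suc m)) < f t0"
    by (intro order_tendstoD(2)[OF LIMSEQ_inverse_real_of_nat])
  then show ?thesis
  proof eventually_elim
    case (elim m)
    show ?case
    proof
      fix t :: real assume "t \<in> {0..1}"
      then have "inverse (real (Suc m)) < f t"
        using t0(2) elim by fastforce
      then show "\<not> (dist z x < a t + inverse (real (Suc m)) \<and> dist z y < b t + inverse (real (Suc m)))"
        by (auto simp: f_def)
    qed
  qed
qed

theorem mainTheorem10:
  fixes n :: nat and p q :: "nat \<Rightarrow> complex" and A :: "nat \<Rightarrow> complex set"
  assumes "same_chain n p q"
    and "expansion n p q"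
    and "\<And>i. i < n \<Longrightarrow> adornment (A i) (p i) (p (Suc i))"
    and "\<And>i. i < n \<Longrightarrow> slender_adornment (A i) (p i) (p (Suc i))"
    and "\<And>i. i < n \<Longrightarrow> symmetric_adornment (A i) (p i) (p (Suc i))"
  shows "measure lebesgue (\<Union>i<n. bar_motion p q i ` A i) \<ge> measure lebesgue (\<Union>i<n. A i)"
proof -
  define rep where "rep = (\<lambda>i g. continuous_on {0..1::real} g \<and>
    A i = {z. \<exists>t\<in>{0..1}. dist z (p i) \<le> dist (g t) (p i) \<and> dist z (p (Suc i)) \<le> dist (g t) (p (Suc i))})"
  have "\<forall>i\<in>{..<n}. \<exists>g. rep i g"
  proof
    fix i assume "i \<in> {..<n}"
    then have i: "i < n"
      by simp
    show "\<exists>g. rep i g"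
      unfolding rep_def by (rule slender_symmetric_eq_lenses[OF assms(4)[OF i] assms(5)[OF i]]) blast
  qed
  from bchoice[OF this] obtain g where "\<And>i. i < n \<Longrightarrow> rep i (g i)"
    by blast
  then have g: "\<And>i. i < n \<Longrightarrow> continuous_on {0..1} (g i)"
    and A: "\<And>i. i < n \<Longrightarrow> A i =
      {z. \<exists>t\<in>{0..1}. dist z (p i) \<le> dist (g i t) (p i) \<and> dist z (p (Suc i)) \<le> dist (g i t) (p (Suc i))}"
    unfolding rep_def by blast+
  define a where "a = (\<lambda>i t. dist (g i t) (p i))"
  define b where "b = (\<lambda>i t. dist (g i t) (p (Suc i)))"
  have cont: "continuous_on {0..1} (a i)" "continuous_on {0..1} (b i)" if "i < n" for i
    unfolding a_def b_def by (intro continuous_intros g that)+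
  have ne: "p i \<noteq> p (Suc i)" and compact: "compact (A i)" if "i < n" for i
    using assms(3)[OF that] unfolding adornment_def adornment_sides_def by blast+
  have rigid: "dist (q i) (q (Suc i)) = dist (p i) (p (Suc i))" if "i < n" for i
    using assms(1) that by (simp add: same_chain_def)
  have expand: "dist (chain_point p i s) (chain_point p j t) \<le> dist (chain_point q i s) (chain_point q j t)"
    if "i < n" "j < n" "s \<in> {0..1}" "t \<in> {0..1}" for i j s t
    using assms(2) that by (simp add: expansion_def)
  define B where "B = (\<lambda>i. {z. \<exists>t\<in>{0..1}. dist z (q i) \<le> a i t \<and> dist z (q (Suc i)) \<le> b i t})"
  have B: "bar_motion p q i ` A i = B i" if "i < n" for i
    unfolding A[OF that] B_def a_def b_def by (rule bar_motion_lenses[OF ne[OF that] rigid[OF that]])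
  \<comment> \<open>Enlarging the radii makes them positive and the lenses open, which permits
    finite subcovers of each \<open>A i\<close>. The enlargement tends to 0, so the closed lenses
    return in the limit.\<close>
  define lens where "lens = (\<lambda>Q :: nat \<Rightarrow> complex. \<lambda>m i t. ball (Q i) (a i t + inverse (real (Suc m)))
      \<inter> ball (Q (Suc i)) (b i t + inverse (real (Suc m))))"
  define U where "U = (\<lambda>m. \<Union>i<n. \<Union>t\<in>{0..1}. lens q m i t)"
  have openU: "open (U m)" for m
    unfolding U_def lens_def by (intro open_UN ballI open_Int open_ball)
  have boundedU: "bounded (U m)" for m
  proof -
    have "bounded (\<Union>t\<in>{0..1}. lens q m i t)" if i: "i < n" for i
    proof -
      obtain t0 where M: "\<And>t. t \<in> {0..1} \<Longrightarrow> a i t \<le> a i t0"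
        using continuous_attains_sup[OF _ _ cont(1)[OF i]] by fastforce
      have "(\<Union>t\<in>{0..1}. lens q m i t) \<subseteq> ball (q i) (a i t0 + inverse (real (Suc m)))"
        unfolding lens_def by (intro UN_least le_infI1 subset_ball add_right_mono M)
      then show ?thesis
        by (rule bounded_subset[OF bounded_ball])
    qed
    then show ?thesis
      unfolding U_def by (intro bounded_UN) auto
  qed
  have finU: "emeasure lborel (U m) < \<infinity>" for m
    by (rule emeasure_bounded_finite[OF boundedU])
  have setsU: "U m \<in> sets lborel" for m
    using openU by simp
  have le: "measure lborel (\<Union>i<n. A i) \<le> measure lborel (U m)" for m
  proof -
    have "\<exists>T. T \<subseteq> {0..1} \<and> finite T \<and> A i \<subseteq> (\<Union>t\<in>T. lens p m i t)" if i: "i < n" for i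
    proof (rule compactE_image[OF compact[OF i], of "{0..1}" "lens p m i"])
      show "A i \<subseteq> (\<Union>t\<in>{0..1}. lens p m i t)"
      proof
        fix z assume "z \<in> A i"
        then obtain t where "t \<in> {0..1}" "dist z (p i) \<le> a i t" "dist z (p (Suc i)) \<le> b i t"
          unfolding A[OF i] a_def b_def by blast
        moreover have "inverse (real (Suc m)) > 0"
          by simp
        ultimately have "z \<in> lens p m i t" "t \<in> {0..1}"
          unfolding lens_def mem_ball Int_iff by (simp_all only: dist_commute[of _ z]) linarith+
        then show "z \<in> (\<Union>t\<in>{0..1}. lens p m i t)"
          by blast
      qed
    qed (auto simp: lens_def)
    then obtain T where T: "\<And>i. i < n \<Longrightarrow> T i \<subseteq> {0..1}" "\<And>i. i < n \<Longrightarrow> finite (T i)"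
      "\<And>i. i < n \<Longrightarrow> A i \<subseteq> (\<Union>t\<in>T i. lens p m i t)"
      by metis
    define K where "K = (SIGMA i:{..<n}. T i)"
    have K: "finite K"
      unfolding K_def using T by auto
    have mono: "measure lborel (\<Union>k\<in>K. ball (p (fst k)) (a (fst k) (snd k) + inverse (real (Suc m)))
          \<inter> ball (p (Suc (fst k))) (b (fst k) (snd k) + inverse (real (Suc m))))
       \<le> measure lborel (\<Union>k\<in>K. ball (q (fst k)) (a (fst k) (snd k) + inverse (real (Suc m)))
          \<inter> ball (q (Suc (fst k))) (b (fst k) (snd k) + inverse (real (Suc m))))"
    proof (rule measure_lens_union_mono[OF K])
      fix k l assume "k \<in> K" "l \<in> K"
      then have kl: "fst k < n" "fst l < n"
        by (auto simp: K_def)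
      \<comment> \<open>The centres are ends of bars, that is, chain points with parameters 0 and 1,
        so the expansion hypothesis supplies the inequalities below.\<close>
      show "dist (p (fst k)) (p (Suc (fst k))) = dist (q (fst k)) (q (Suc (fst k)))"
        using rigid kl by simp
      show "dist (p (fst k)) (p (fst l)) \<le> dist (q (fst k)) (q (fst l))"
        using expand[OF kl, of 0 0] by (simp add: chain_point_def)
      show "dist (p (fst k)) (p (Suc (fst l))) \<le> dist (q (fst k)) (q (Suc (fst l)))"
        using expand[OF kl, of 0 1] by (simp add: chain_point_def)
      show "dist (p (Suc (fst k))) (p (Suc (fst l))) \<le> dist (q (Suc (fst k))) (q (Suc (fst l)))"
        using expand[OF kl, of 1 1] by (simp add: chain_point_def)
      show "0 < a (fst k) (snd k) + inverse (real (Suc m)) \<and> 0 < b (fst k) (snd k) + inverse (real (Suc m))"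
        unfolding a_def b_def by (auto intro!: add_nonneg_pos)
    qed
    have K_UN: "(\<Union>k\<in>K. ball (Q (fst k)) (a (fst k) (snd k) + inverse (real (Suc m)))
          \<inter> ball (Q (Suc (fst k))) (b (fst k) (snd k) + inverse (real (Suc m))))
        = (\<Union>i<n. \<Union>t\<in>T i. lens Q m i t)" for Q
      unfolding K_def lens_def by force
    have "measure lborel (\<Union>i<n. A i) \<le> measure lborel (\<Union>i<n. \<Union>t\<in>T i. lens p m i t)"
    proof (rule measure_mono_fmeasurable)
      show "(\<Union>i<n. A i) \<subseteq> (\<Union>i<n. \<Union>t\<in>T i. lens p m i t)"
        using T(3) by blast
      show "(\<Union>i<n. A i) \<in> sets lborel"
        using compact by (auto intro!: borel_closed compact_imp_closed)
      have "bounded (\<Union>i<n. \<Union>t\<in>T i. lens p m i t)"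
        using T(2) unfolding lens_def by auto
      moreover have "open (\<Union>i<n. \<Union>t\<in>T i. lens p m i t)"
        unfolding lens_def by auto
      ultimately show "(\<Union>i<n. \<Union>t\<in>T i. lens p m i t) \<in> fmeasurable lborel"
        by (intro fmeasurableI emeasure_bounded_finite) simp_all
    qed
    also have "\<dots> \<le> measure lborel (\<Union>i<n. \<Union>t\<in>T i. lens q m i t)"
      using mono unfolding K_UN .
    also have "\<dots> \<le> measure lborel (U m)"
    proof (rule measure_mono_fmeasurable)
      show "(\<Union>i<n. \<Union>t\<in>T i. lens q m i t) \<subseteq> U m"
        using T(1) unfolding U_def by blast
      show "(\<Union>i<n. \<Union>t\<in>T i. lens q m i t) \<in> sets lborel"
        unfolding lens_def by (auto intro!: borel_open)
      show "U m \<in> fmeasurable lborel"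
        using finU setsU by (simp add: fmeasurable_def)
    qed
    finally show ?thesis .
  qed
  \<comment> \<open>Continuity of the measure from above, available since each \<open>U m\<close>
    has finite measure.\<close>
  have lim: "(\<lambda>m. measure lborel (U m)) \<longlonglongrightarrow> measure lborel (\<Inter>m. U m)"
  proof (rule Lim_measure_decseq)
    show "range U \<subseteq> sets lborel" "\<And>m. emeasure lborel (U m) \<noteq> \<infinity>"
      using setsU finU by (auto simp: less_top)
    have "lens q (Suc m) i t \<subseteq> lens q m i t" for m i t
      unfolding lens_def by (intro Int_mono subset_ball add_left_mono le_imp_inverse_le) auto
    then show "decseq U"
      unfolding U_def by (intro decseq_SucI) blast
  qed
  have inter: "(\<Inter>m. U m) = (\<Union>i<n. B i)"
  proof
    show "(\<Union>i<n. B i) \<subseteq> (\<Inter>m. U m)"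
    proof (intro INT_greatest UN_least subsetI)
      fix m i z assume i: "i \<in> {..<n}" and "z \<in> B i"
      then obtain t where t: "t \<in> {0..1}" "dist z (q i) \<le> a i t" "dist z (q (Suc i)) \<le> b i t"
        unfolding B_def by blast
      moreover have "inverse (real (Suc m)) > 0"
        by simp
      ultimately have "z \<in> lens q m i t"
        unfolding lens_def mem_ball Int_iff by (simp only: dist_commute[of _ z]) linarith
      with i t(1) show "z \<in> U m"
        unfolding U_def by blast
    qed
    \<comment> \<open>A point outside all \<open>B i\<close> leaves the enlarged lenses of each bar
      from some \<open>m\<close> on, and finitely many bars admit a common \<open>m\<close>.\<close>
    show "(\<Inter>m. U m) \<subseteq> (\<Union>i<n. B i)"
    proof (rule ccontr)
      assume "\<not> ?thesis"
      then obtain z where z: "\<And>m. z \<in> U m" and zB: "\<And>i. i < n \<Longrightarrow> z \<notin> B i"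
        by blast
      have "\<forall>i\<in>{..<n}. \<forall>\<^sub>F m in sequentially. \<forall>t\<in>{0..1}. z \<notin> lens q m i t"
      proof
        fix i assume "i \<in> {..<n}"
        then have i: "i < n"
          by simp
        have "\<forall>\<^sub>F m in sequentially. \<forall>t\<in>{0..1}. \<not> (dist z (q i) < a i t + inverse (real (Suc m))
            \<and> dist z (q (Suc i)) < b i t + inverse (real (Suc m)))"
          using zB[OF i] by (intro eventually_not_near_lenses cont i) (auto simp: B_def)
        then show "\<forall>\<^sub>F m in sequentially. \<forall>t\<in>{0..1}. z \<notin> lens q m i t"
          unfolding lens_def mem_ball Int_iff by (simp only: dist_commute[of _ z])
      qed
      then have "\<forall>\<^sub>F m in sequentially. \<forall>i\<in>{..<n}. \<forall>t\<in>{0..1}. z \<notin> lens q m i t"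
        by (intro eventually_ball_finite) auto
      then obtain m where "\<forall>i\<in>{..<n}. \<forall>t\<in>{0..1}. z \<notin> lens q m i t"
        using eventually_happens' sequentially_bot by blast
      then show False
        using z[of m] unfolding U_def by blast
    qed
  qed
  have "measure lborel (\<Union>i<n. A i) \<le> measure lborel (\<Union>i<n. B i)"
    using lim le unfolding inter by (intro LIMSEQ_le_const) auto
  moreover have "(\<Union>i<n. A i) \<in> sets lborel"
    using compact by (auto intro!: borel_closed compact_imp_closed)
  moreover have "(\<Union>i<n. B i) \<in> sets lborel"
    unfolding inter[symmetric] using setsU by (intro sets.countable_INT) auto
  moreover have "(\<Union>i<n. bar_motion p q i ` A i) = (\<Union>i<n. B i)"
    using B by simp
  ultimately show ?thesis
    by (simp add: measure_completion)
qed

end
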